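(* Let $c>0$, $l<L$, $N\ge 2$, let $l=x_0<x_1<\cdots<x_N=L$, put $\Omega_i=(x_{i-1},x_i)\times(0,\pi)$, $h_i=x_i-x_{i-1}$ for $1\le i\le N$, and $h_{\min}=\min_{1\le i\le N}h_i$. Consider the Neumann-Neumann Waveform Relaxation (NNWR) algorithm for the error equations of the two-dimensional wave equation $\partial_{tt}u-c^2\Delta u=f$ on $(l,L)\times(0,\pi)$, $t\in(0,T]$, as defined in the context, with relaxation parameter $\theta=1/4$ and arbitrary initial guesses $w_1^0,\dots,w_{N-1}^0$. Let $k\ge 1$ be an integer. For $T>0$ fixed, if the time window length $T$ satisfies $$\frac{T}{k}<\frac{2h_{\min}}{c},$$ then the NNWR algorithm converges in $k+1$ iterations, i.e. the error iterates satisfy $u_i^{k+1}\equiv 0$ on $\Omega_i\times(0,T)$ for every $i=1,\dots,N$.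
   Context: NNWR algorithm in 2D for a decomposition into strips, error equations (zero source, zero initial data, homogeneous Dirichlet boundary data; the exact solution of the error problem is zero). One is given initial guesses $w_i^0(y,t)$, $y\in(0,\pi)$, $t\in(0,T)$, $1\le i\le N-1$, along the interfaces $\{x=x_i\}$, and sets $w_0^k=w_N^k=0$ for all $k\ge 0$. Let $\partial_{n_i}$ denote the derivative in the direction of the unit outward normal of $\Omega_i$ (so $\partial_{n_i}=-\partial_x$ at $x=x_{i-1}$ and $\partial_{n_i}=\partial_x$ at $x=x_i$). For $k=1,2,\dots$ one performs the following steps. (1) Dirichlet step: for each $i=1,\dots,N$, $u_i^k$ solves $$\partial_{tt}u_i^k-c^2\Delta u_i^k=0\ \text{ in }\Omega_i,\quad u_i^k(x,y,0)=0,\quad \partial_tu_i^k(x,y,0)=0,$$ $$u_i^k(x_{i-1},y,t)=w_{i-1}^{k-1}(y,t),\quad u_i^k(x_i,y,t)=w_i^{k-1}(y,t),\quad u_i^k(x,0,t)=u_i^k(x,\pi,t)=0.$$ (2) Neumann step: for each $i=1,\dots,N$, $\varphi_i^k$ solves $$\partial_{tt}\varphi_i^k-c^2\Delta\varphi_i^k=0\ \text{ in }\Omega_i,\quad \varphi_i^k(x,y,0)=0,\quad \partial_t\varphi_i^k(x,y,0)=0,$$ $$\partial_{n_i}\varphi_i^k(x_{i-1},y,t)=(\partial_{n_{i-1}}u_{i-1}^k+\partial_{n_i}u_i^k)(x_{i-1},y,t),\quad \partial_{n_i}\varphi_i^k(x_i,y,t)=(\partial_{n_i}u_i^k+\partial_{n_{i+1}}u_{i+1}^k)(x_i,y,t),$$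 $$\varphi_i^k(x,0,t)=\varphi_i^k(x,\pi,t)=0,$$ except that for the first and last subdomains the Neumann condition at the physical boundary is replaced by a homogeneous Dirichlet condition: $\varphi_1^k(l,y,t)=0$ and $\varphi_N^k(L,y,t)=0$. (3) Update: for $i=1,\dots,N-1$, $$w_i^k(y,t)=w_i^{k-1}(y,t)-\theta\left(\varphi_i^k(x_i,y,t)+\varphi_{i+1}^k(x_i,y,t)\right),$$ where $\theta\in(0,1]$ is the relaxation parameter. "Converges in $m$ iterations" means that the $m$-th Dirichlet iterates $u_i^m$ coincide with the exact solution on all subdomains and the whole time window (for the error equations: are identically zero). The initial guesses are understood to be regular enough that the subdomain problems are solvable, the traces used make sense, and Fourier sine series in $y$ and Laplace transforms in $t$ can be applied (data on $(0,T)$ may be extended to $t>0$). *)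

theory Defs
  imports "HOL-Analysis.Analysis"
begin

type_synonym field = "real \<times> real \<times> real \<Rightarrow> real"  \<comment> \<open>functions of (x, y, t)\<close>

text \<open>
  Partial derivatives of a function on a product of intervals \<open>X \<times> Y \<times> S\<close>. They are taken within the
  respective interval: one-sided at an end point that belongs to it, and the ordinary
  derivative at interior points.
\<close>

definition Dx :: "real set \<Rightarrow> field \<Rightarrow> field" where
  "Dx X v = (\<lambda>(x, y, t). vector_derivative (\<lambda>\<xi>. v (\<xi>, y, t)) (at x within X))"

definition Dy :: "real set \<Rightarrow> field \<Rightarrow> field" where
  "Dy Y v = (\<lambda>(x, y, t). vector_derivative (\<lambda>\<eta>. v (x, \<eta>, t)) (at y within Y))"

definition Dt :: "real set \<Rightarrow> field \<Rightarrow> field" where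
  "Dt S v = (\<lambda>(x, y, t). vector_derivative (\<lambda>s. v (x, y, s)) (at t within S))"

definition C1_on :: "real set \<Rightarrow> real set \<Rightarrow> real set \<Rightarrow> field \<Rightarrow> bool" where
  "C1_on X Y S v \<longleftrightarrow>
     continuous_on (X \<times> Y \<times> S) v \<and>
     (\<forall>x\<in>X. \<forall>y\<in>Y. \<forall>t\<in>S.
        (\<lambda>\<xi>. v (\<xi>, y, t)) differentiable (at x within X) \<and>
        (\<lambda>\<eta>. v (x, \<eta>, t)) differentiable (at y within Y) \<and>
        (\<lambda>s. v (x, y, s)) differentiable (at t within S)) \<and>
     continuous_on (X \<times> Y \<times> S) (Dx X v) \<and>
     continuous_on (X \<times> Y \<times> S) (Dy Y v) \<and>
     continuous_on (X \<times> Y \<times> S) (Dt S v)"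

definition C2_on :: "real set \<Rightarrow> real set \<Rightarrow> real set \<Rightarrow> field \<Rightarrow> bool" where
  "C2_on X Y S v \<longleftrightarrow>
     C1_on X Y S v \<and> C1_on X Y S (Dx X v) \<and> C1_on X Y S (Dy Y v) \<and> C1_on X Y S (Dt S v)"

text \<open>
  Classical solutions on the strip \<open>(a, b) \<times> (0, \<pi>)\<close> over the time window \<open>(0, T)\<close>: twice
  continuously differentiable in the open space-time domain, and continuously differentiable
  up to the boundary and up to \<open>t = 0\<close>, so that Dirichlet and Neumann traces are defined.
  The initial data and the data on \<open>y = 0\<close> and \<open>y = \<pi>\<close> are zero.
\<close>

definition wave_solution :: "real \<Rightarrow> real \<Rightarrow> real \<Rightarrow> real \<Rightarrow> field \<Rightarrow> bool" where
  "wave_solution c T a b v \<longleftrightarrow>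
     C1_on {a..b} {0..pi} {0..<T} v \<and>
     C2_on {a<..<b} {0<..<pi} {0<..<T} v \<and>
     (\<forall>x\<in>{a<..<b}. \<forall>y\<in>{0<..<pi}. \<forall>t\<in>{0<..<T}.
        Dt {0<..<T} (Dt {0<..<T} v) (x, y, t)
          - c\<^sup>2 * (Dx {a<..<b} (Dx {a<..<b} v) (x, y, t)
                   + Dy {0<..<pi} (Dy {0<..<pi} v) (x, y, t)) = 0) \<and>
     (\<forall>x\<in>{a<..<b}. \<forall>y\<in>{0<..<pi}.
        v (x, y, 0) = 0 \<and> Dt {0..<T} v (x, y, 0) = 0) \<and>
     (\<forall>x\<in>{a<..<b}. \<forall>t\<in>{0<..<T}. v (x, 0, t) = 0 \<and> v (x, pi, t) = 0)"

text \<open>Traces of the outward normal derivative at the left and right end of \<open>(a, b)\<close>.\<close>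

definition dn_left :: "real \<Rightarrow> real \<Rightarrow> field \<Rightarrow> real \<Rightarrow> real \<Rightarrow> real" where
  "dn_left a b v y t = - Dx {a..b} v (a, y, t)"

definition dn_right :: "real \<Rightarrow> real \<Rightarrow> field \<Rightarrow> real \<Rightarrow> real \<Rightarrow> real" where
  "dn_right a b v y t = Dx {a..b} v (b, y, t)"

text \<open>
  The subdomain with index \<open>i\<close> is \<open>(x (i - 1), x i) \<times> (0, \<pi>)\<close> for \<open>1 \<le> i \<le> N\<close>; iterates carry
  the iteration index first and the subdomain (or interface) index second.
\<close>

definition dirichlet_step ::
  "real \<Rightarrow> real \<Rightarrow> nat \<Rightarrow> (nat \<Rightarrow> real) \<Rightarrow> (nat \<Rightarrow> real \<Rightarrow> real \<Rightarrow> real) \<Rightarrow> (nat \<Rightarrow> field) \<Rightarrow> bool" where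
  "dirichlet_step c T N x w u \<longleftrightarrow>
     (\<forall>i\<in>{1..N}.
        wave_solution c T (x (i - 1)) (x i) (u i) \<and>
        (\<forall>y\<in>{0<..<pi}. \<forall>t\<in>{0<..<T}.
           u i (x (i - 1), y, t) = w (i - 1) y t \<and> u i (x i, y, t) = w i y t))"

definition neumann_step ::
  "real \<Rightarrow> real \<Rightarrow> nat \<Rightarrow> (nat \<Rightarrow> real) \<Rightarrow> (nat \<Rightarrow> field) \<Rightarrow> (nat \<Rightarrow> field) \<Rightarrow> bool" where
  "neumann_step c T N x u \<phi> \<longleftrightarrow>
     (\<forall>i\<in>{1..N}.
        wave_solution c T (x (i - 1)) (x i) (\<phi> i) \<and>
        (\<forall>y\<in>{0<..<pi}. \<forall>t\<in>{0<..<T}.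
           (if i = 1 then \<phi> i (x 0, y, t) = 0
            else dn_left (x (i - 1)) (x i) (\<phi> i) y t
                 = dn_right (x (i - 2)) (x (i - 1)) (u (i - 1)) y t
                   + dn_left (x (i - 1)) (x i) (u i) y t) \<and>
           (if i = N then \<phi> i (x N, y, t) = 0
            else dn_right (x (i - 1)) (x i) (\<phi> i) y t
                 = dn_right (x (i - 1)) (x i) (u i) y t
                   + dn_left (x i) (x (i + 1)) (u (i + 1)) y t)))"

text \<open>
  \<open>w 0\<close> are the initial guesses. They are subject to no condition besides the existence of the
  classical solutions \<open>u k i\<close>, \<open>\<phi> k i\<close> of the subdomain problems.
\<close>

definition NNWR ::
  "real \<Rightarrow> real \<Rightarrow> nat \<Rightarrow> (nat \<Rightarrow> real) \<Rightarrow> real \<Rightarrow> (nat \<Rightarrow> nat \<Rightarrow> real \<Rightarrow> real \<Rightarrow> real) \<Rightarrow>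
   (nat \<Rightarrow> nat \<Rightarrow> field) \<Rightarrow> (nat \<Rightarrow> nat \<Rightarrow> field) \<Rightarrow> bool" where
  "NNWR c T N x \<theta> w u \<phi> \<longleftrightarrow>
     (\<forall>k. \<forall>y\<in>{0<..<pi}. \<forall>t\<in>{0<..<T}. w k 0 y t = 0 \<and> w k N y t = 0) \<and>
     (\<forall>k\<ge>1.
        dirichlet_step c T N x (w (k - 1)) (u k) \<and>
        neumann_step c T N x (u k) (\<phi> k) \<and>
        (\<forall>i\<in>{1..N - 1}. \<forall>y\<in>{0<..<pi}. \<forall>t\<in>{0<..<T}.
           w k i y t = w (k - 1) i y t
             - \<theta> * (\<phi> k i (x i, y, t) + \<phi> k (i + 1) (x i, y, t))))"

end

theory Submission
  imports Defs
begin

text \<open>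
  The argument uses only finite speed of propagation, proved by a local energy estimate. Suppose the
  interface values vanish up to time \<open>s\<close>, and let \<open>h\<close> be the smallest width.

  Until \<open>s + h / c\<close> no signal has crossed a subdomain, so near an interface the Dirichlet solutions
  on the two sides are mirror images of each other and their outward normal derivatives agree. Hence
  the Neumann data of \<open>\<phi>\<^sub>i\<close> are twice the normal derivatives of \<open>u\<^sub>i\<close>, and \<open>\<phi>\<^sub>i = 2 u\<^sub>i\<close> up to that
  time. Fold \<open>\<Omega>\<^bsub>i+1\<^esub>\<close> onto \<open>\<Omega>\<^sub>i\<close> at the interface \<open>x = x\<^sub>i\<close>: the sum of \<open>\<phi>\<^sub>i - 2 u\<^sub>i\<close> and the reflected
  \<open>\<phi>\<^bsub>i+1\<^esub> - 2 u\<^bsub>i+1\<^esub>\<close> has homogeneous Neumann data at the interface at all times and vanishes until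
  \<open>s + h / c\<close>, so at the interface it vanishes until \<open>s + 2 h / c\<close>. There it equals
  \<open>\<phi>\<^sub>i + \<phi>\<^bsub>i+1\<^esub> - 4 w\<^sub>i\<close>, so with \<open>\<theta> = 1/4\<close> each iteration clears a further time interval of length
  \<open>2 h / c\<close>.
\<close>

subsection \<open>Calculus on boxes\<close>

text \<open>Schwarz's theorem. The second difference of \<open>f\<close> over a small square,
  evaluated by the mean value theorem in either order, is \<open>h * h\<close> times a value of
  \<open>fxt\<close> and also \<open>h * h\<close> times a value of \<open>ftx\<close>; continuity
  brings both close to their values at the corner. \<open>C2_on\<close> supplies the two mixed
  derivatives as unrelated fields, and the energy identity needs them equal.\<close>

lemma mixed_partials_eq:
  fixes f fx ft fxt ftx :: "real \<times> real \<Rightarrow> real"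
  assumes "open X" "open S" "x \<in> X" "t \<in> S"
    and fx: "\<And>x t. x \<in> X \<Longrightarrow> t \<in> S \<Longrightarrow> ((\<lambda>\<xi>. f (\<xi>, t)) has_real_derivative fx (x, t)) (at x)"
    and ft: "\<And>x t. x \<in> X \<Longrightarrow> t \<in> S \<Longrightarrow> ((\<lambda>s. f (x, s)) has_real_derivative ft (x, t)) (at t)"
    and fxt: "\<And>x t. x \<in> X \<Longrightarrow> t \<in> S \<Longrightarrow> ((\<lambda>s. fx (x, s)) has_real_derivative fxt (x, t)) (at t)"
    and ftx: "\<And>x t. x \<in> X \<Longrightarrow> t \<in> S \<Longrightarrow> ((\<lambda>\<xi>. ft (\<xi>, t)) has_real_derivative ftx (x, t)) (at x)"
    and cont: "continuous_on (X \<times> S) fxt" "continuous_on (X \<times> S) ftx"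
  shows "fxt (x, t) = ftx (x, t)"
proof -
  have opn: "open (X \<times> S)" and xt: "(x, t) \<in> X \<times> S" using assms(1-4) by (auto intro: open_Times)
  have lims: "(fxt \<longlongrightarrow> fxt (x, t)) (nhds (x, t))" "(ftx \<longlongrightarrow> ftx (x, t)) (nhds (x, t))"
    using cont opn xt by (metis continuous_on_eq_continuous_at isCont_def tendsto_at_iff_tendsto_nhds)+
  have close: "\<bar>fxt (x, t) - ftx (x, t)\<bar> \<le> 2 * e" if e: "e > 0" for e
  proof -
    have "\<forall>\<^sub>F z in nhds (x, t). \<bar>fxt z - fxt (x, t)\<bar> < e \<and> \<bar>ftx z - ftx (x, t)\<bar> < e \<and> z \<in> X \<times> S"
      using tendstoD[OF lims(1) e] tendstoD[OF lims(2) e] eventually_nhds_in_open[OF opn xt]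
      unfolding dist_real_def by eventually_elim auto
    then have "\<forall>\<^sub>F p in nhds x \<times>\<^sub>F nhds t.
        \<bar>fxt p - fxt (x, t)\<bar> < e \<and> \<bar>ftx p - ftx (x, t)\<bar> < e \<and> p \<in> X \<times> S"
      by (simp add: nhds_prod)
    then obtain P Q where P: "eventually P (nhds x)" and Q: "eventually Q (nhds t)"
      and PQ: "\<And>\<xi> \<tau>. P \<xi> \<Longrightarrow> Q \<tau> \<Longrightarrow> \<bar>fxt (\<xi>, \<tau>) - fxt (x, t)\<bar> < e
        \<and> \<bar>ftx (\<xi>, \<tau>) - ftx (x, t)\<bar> < e \<and> (\<xi>, \<tau>) \<in> X \<times> S"
      unfolding eventually_prod_filter by blast
    obtain d1 where d1: "d1 > 0" "\<And>\<xi>. dist \<xi> x < d1 \<Longrightarrow> P \<xi>" using P unfolding eventually_nhds_metric by auto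
    obtain d2 where d2: "d2 > 0" "\<And>\<tau>. dist \<tau> t < d2 \<Longrightarrow> Q \<tau>" using Q unfolding eventually_nhds_metric by auto
    define h where "h = min d1 d2 / 2"
    have h: "h > 0" "h < d1" "h < d2" using d1(1) d2(1) by (auto simp: h_def)
    have near: "\<bar>fxt (\<xi>, \<tau>) - fxt (x, t)\<bar> < e" "\<bar>ftx (\<xi>, \<tau>) - ftx (x, t)\<bar> < e" "\<xi> \<in> X" "\<tau> \<in> S"
      if "x \<le> \<xi>" "\<xi> \<le> x + h" "t \<le> \<tau>" "\<tau> \<le> t + h" for \<xi> \<tau>
      using PQ[OF d1(2) d2(2), of \<xi> \<tau>] that h by (auto simp: dist_real_def)
    have X: "\<xi> \<in> X" if "x \<le> \<xi>" "\<xi> \<le> x + h" for \<xi> using near(3)[of \<xi> t] that h by simp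
    have S: "\<tau> \<in> S" if "t \<le> \<tau>" "\<tau> \<le> t + h" for \<tau> using near(4)[of x \<tau>] that h by simp
    have "\<exists>\<xi>>x. \<xi> < x + h \<and> (f (x + h, t + h) - f (x + h, t)) - (f (x, t + h) - f (x, t))
        = (x + h - x) * (fx (\<xi>, t + h) - fx (\<xi>, t))"
      by (rule MVT2[where f="\<lambda>\<xi>. f (\<xi>, t + h) - f (\<xi>, t)"])
        (use h X S in \<open>auto intro!: derivative_eq_intros fx\<close>)
    then obtain \<xi> where \<xi>: "x < \<xi>" "\<xi> < x + h" and eq1:
      "f (x + h, t + h) - f (x + h, t) - (f (x, t + h) - f (x, t)) = h * (fx (\<xi>, t + h) - fx (\<xi>, t))"
      by auto
    have "\<exists>\<tau>>t. \<tau> < t + h \<and> fx (\<xi>, t + h) - fx (\<xi>, t) = (t + h - t) * fxt (\<xi>, \<tau>)"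
      by (rule MVT2[where f="\<lambda>\<tau>. fx (\<xi>, \<tau>)"]) (use h X S \<xi> in \<open>auto intro!: derivative_eq_intros fxt\<close>)
    then obtain \<tau> where \<tau>: "t < \<tau>" "\<tau> < t + h" "fx (\<xi>, t + h) - fx (\<xi>, t) = h * fxt (\<xi>, \<tau>)" by auto
    have "\<exists>\<tau>>t. \<tau> < t + h \<and> (f (x + h, t + h) - f (x, t + h)) - (f (x + h, t) - f (x, t))
        = (t + h - t) * (ft (x + h, \<tau>) - ft (x, \<tau>))"
      by (rule MVT2[where f="\<lambda>\<tau>. f (x + h, \<tau>) - f (x, \<tau>)"])
        (use h X S in \<open>auto intro!: derivative_eq_intros ft\<close>)
    then obtain \<tau>' where \<tau>': "t < \<tau>'" "\<tau>' < t + h" and eq2: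
      "f (x + h, t + h) - f (x, t + h) - (f (x + h, t) - f (x, t)) = h * (ft (x + h, \<tau>') - ft (x, \<tau>'))"
      by auto
    have "\<exists>\<xi>'>x. \<xi>' < x + h \<and> ft (x + h, \<tau>') - ft (x, \<tau>') = (x + h - x) * ftx (\<xi>', \<tau>')"
      by (rule MVT2[where f="\<lambda>\<xi>. ft (\<xi>, \<tau>')"]) (use h X S \<tau>' in \<open>auto intro!: derivative_eq_intros ftx\<close>)
    then obtain \<xi>' where \<xi>': "x < \<xi>'" "\<xi>' < x + h" "ft (x + h, \<tau>') - ft (x, \<tau>') = h * ftx (\<xi>', \<tau>')" by auto
    have "h * (h * fxt (\<xi>, \<tau>)) = h * (h * ftx (\<xi>', \<tau>'))"
      using eq1 eq2 \<tau>(3) \<xi>'(3) by (simp add: algebra_simps)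
    then have "fxt (\<xi>, \<tau>) = ftx (\<xi>', \<tau>')" using h by simp
    then show ?thesis using near(1)[of \<xi> \<tau>] near(2)[of \<xi>' \<tau>'] \<xi> \<xi>' \<tau> \<tau>' by auto
  qed
  show ?thesis
  proof (rule ccontr)
    assume "fxt (x, t) \<noteq> ftx (x, t)"
    \<comment> \<open>With a quarter of the gap as \<open>e\<close>, the bound \<open>2 * e\<close>
      is half the gap, which is absurd.\<close>
    then have "\<bar>fxt (x, t) - ftx (x, t)\<bar> / 4 > 0" by simp
    from close[OF this] \<open>fxt (x, t) \<noteq> ftx (x, t)\<close> show False by simp
  qed
qed

text \<open>The divergence theorem as an inequality: the time derivative of the integral of
  \<open>P\<close> is at most the net flux through the four sides. The fluxes and the initial value
  are allowed to be of size \<epsilon> because the lemma is applied on boxes whose faces are only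
  near those where the data vanish. The factor of \<epsilon> is the area of the bottom face plus
  that of the lateral faces.\<close>

lemma integral_box_growth_le:
  fixes P Pt Q Qx R Ry :: "real \<times> real \<times> real \<Rightarrow> real"
  assumes ab: "a \<le> b" and cd: "c \<le> d" and s: "s0 < s1"
    and derivs: "\<And>x y t. x \<in> {a..b} \<Longrightarrow> y \<in> {c..d} \<Longrightarrow> t \<in> {s0..s1} \<Longrightarrow>
      ((\<lambda>s. P (x, y, s)) has_real_derivative Pt (x, y, t)) (at t) \<and>
      ((\<lambda>\<xi>. Q (\<xi>, y, t)) has_real_derivative Qx (x, y, t)) (at x) \<and>
      ((\<lambda>\<eta>. R (x, \<eta>, t)) has_real_derivative Ry (x, y, t)) (at y)"
    and cont: "continuous_on ({a..b} \<times> {c..d} \<times> {s0..s1}) P"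
      "continuous_on ({a..b} \<times> {c..d} \<times> {s0..s1}) Q"
      "continuous_on ({a..b} \<times> {c..d} \<times> {s0..s1}) R"
      "continuous_on ({a..b} \<times> {c..d} \<times> {s0..s1}) Pt"
      "continuous_on ({a..b} \<times> {c..d} \<times> {s0..s1}) Qx"
      "continuous_on ({a..b} \<times> {c..d} \<times> {s0..s1}) Ry"
    and le: "\<And>x y t. x \<in> {a..b} \<Longrightarrow> y \<in> {c..d} \<Longrightarrow> t \<in> {s0..s1} \<Longrightarrow> Pt (x, y, t) \<le> Qx (x, y, t) + Ry (x, y, t)"
    and P0: "\<And>x y. x \<in> {a..b} \<Longrightarrow> y \<in> {c..d} \<Longrightarrow> \<bar>P (x, y, s0)\<bar> \<le> \<epsilon>"
    and Q: "\<And>y t. y \<in> {c..d} \<Longrightarrow> t \<in> {s0..s1} \<Longrightarrow> \<bar>Q (a, y, t)\<bar> \<le> \<epsilon> \<and> \<bar>Q (b, y, t)\<bar> \<le> \<epsilon>"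
    and R: "\<And>x t. x \<in> {a..b} \<Longrightarrow> t \<in> {s0..s1} \<Longrightarrow> \<bar>R (x, c, t)\<bar> \<le> \<epsilon> \<and> \<bar>R (x, d, t)\<bar> \<le> \<epsilon>"
  shows "integral (cbox (a, c) (b, d)) (\<lambda>z. P (fst z, snd z, s1))
    \<le> \<epsilon> * ((b - a) * (d - c) + 2 * (s1 - s0) * ((d - c) + (b - a)))"
proof -
  let ?B = "cbox (a, c) (b, d)"
  define g where "g t = integral ?B (\<lambda>z. P (fst z, snd z, t))" for t
  define g' where "g' t = integral ?B (\<lambda>z. Pt (fst z, snd z, t))" for t
  have B: "?B = {a..b} \<times> {c..d}" by (simp add: cbox_Pair_eq)
  have slice: "continuous_on ?B (\<lambda>z. F (fst z, snd z, t))"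
    if "continuous_on ({a..b} \<times> {c..d} \<times> {s0..s1}) F" "t \<in> {s0..s1}" for F :: "real \<times> real \<times> real \<Rightarrow> real" and t
    unfolding B by (rule continuous_on_compose2[OF that(1)]) (use that(2) in \<open>auto intro!: continuous_intros\<close>)
  have der: "(g has_real_derivative g' t) (at t within {s0..s1})" if t: "t \<in> {s0..s1}" for t
    unfolding g_def g'_def
  proof (rule leibniz_rule_field_derivative[OF _ _ _ t])
    show "((\<lambda>t. P (fst z, snd z, t)) has_real_derivative Pt (fst z, snd z, t)) (at t within {s0..s1})"
      if "t \<in> {s0..s1}" "z \<in> ?B" for t z
      using derivs[of "fst z" "snd z" t] that unfolding B by (auto intro: has_field_derivative_at_within)
    show "(\<lambda>z. P (fst z, snd z, t)) integrable_on ?B" if "t \<in> {s0..s1}" for t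
      using slice[OF cont(1) that] by (rule integrable_continuous)
    show "continuous_on ({s0..s1} \<times> ?B) (\<lambda>(t, z). Pt (fst z, snd z, t))"
      unfolding B split_beta by (rule continuous_on_compose2[OF cont(4)]) (auto intro!: continuous_intros)
  qed auto
  have bound: "g' t \<le> 2 * \<epsilon> * ((d - c) + (b - a))" if t: "t \<in> {s0..s1}" for t
  proof -
    have "g' t \<le> integral ?B (\<lambda>z. Qx (fst z, snd z, t) + Ry (fst z, snd z, t))"
      unfolding g'_def
    proof (intro integral_le integrable_continuous continuous_on_add slice t cont)
      show "Pt (fst z, snd z, t) \<le> Qx (fst z, snd z, t) + Ry (fst z, snd z, t)" if "z \<in> ?B" for z
        using le[of "fst z" "snd z" t] that t unfolding B by auto
    qed
    also have "\<dots> = integral ?B (\<lambda>z. Qx (fst z, snd z, t)) + integral ?B (\<lambda>z. Ry (fst z, snd z, t))"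
      by (rule integral_add) (use slice[OF cont(5) t] slice[OF cont(6) t] in \<open>auto intro!: integrable_continuous\<close>)
    also have "integral ?B (\<lambda>z. Ry (fst z, snd z, t)) \<le> \<epsilon> * 2 * (b - a)"
    proof -
      have "integral ?B (\<lambda>z. Ry (fst z, snd z, t)) = integral (cbox a b) (\<lambda>x. integral (cbox c d) (\<lambda>y. Ry (x, y, t)))"
        using integral_prod_continuous[OF slice[OF cont(6) t]] by simp
      also have "\<dots> = integral (cbox a b) (\<lambda>x. R (x, d, t) - R (x, c, t))"
      proof (rule integral_cong)
        fix x assume x: "x \<in> cbox a b"
        have "((\<lambda>y. Ry (x, y, t)) has_integral R (x, d, t) - R (x, c, t)) {c..d}"
          by (rule fundamental_theorem_of_calculus[OF cd])
            (use derivs[THEN conjunct2, THEN conjunct2, THEN has_field_derivative_at_within] x t in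
              \<open>auto simp: has_real_derivative_iff_has_vector_derivative[symmetric]\<close>)
        then show "integral (cbox c d) (\<lambda>y. Ry (x, y, t)) = R (x, d, t) - R (x, c, t)"
          by (simp add: integral_unique)
      qed
      also have "\<dots> \<le> integral (cbox a b) (\<lambda>x. \<epsilon> * 2)"
      proof (rule integral_le)
        show "(\<lambda>x. R (x, d, t) - R (x, c, t)) integrable_on cbox a b"
          by (intro integrable_continuous continuous_on_diff continuous_on_compose2[OF cont(3)])
            (use t cd in \<open>auto intro!: continuous_intros\<close>)
        show "R (x, d, t) - R (x, c, t) \<le> \<epsilon> * 2" if "x \<in> cbox a b" for x
          using R[of x t] that t by auto
      qed auto
      finally show ?thesis using ab by (simp add: mult_ac)
    qed
    also have "integral ?B (\<lambda>z. Qx (fst z, snd z, t)) \<le> \<epsilon> * 2 * (d - c)"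
    proof -
      have "integral ?B (\<lambda>z. Qx (fst z, snd z, t)) = integral (cbox a b) (\<lambda>x. integral (cbox c d) (\<lambda>y. Qx (x, y, t)))"
        using integral_prod_continuous[OF slice[OF cont(5) t]] by simp
      \<comment> \<open>Integrating in the opposite order makes \<open>x\<close> the inner variable,
        in which \<open>Qx\<close> is an exact derivative.\<close>
      also have "\<dots> = integral (cbox c d) (\<lambda>y. integral (cbox a b) (\<lambda>x. Qx (x, y, t)))"
        using integral_swap_continuous[of a c b d "\<lambda>x y. Qx (x, y, t)"] slice[OF cont(5) t]
        by (simp add: split_beta)
      also have "\<dots> = integral (cbox c d) (\<lambda>y. Q (b, y, t) - Q (a, y, t))"
      proof (rule integral_cong)
        fix y assume y: "y \<in> cbox c d"
        have "((\<lambda>x. Qx (x, y, t)) has_integral Q (b, y, t) - Q (a, y, t)) {a..b}"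
          by (rule fundamental_theorem_of_calculus[OF ab])
            (use derivs[THEN conjunct2, THEN conjunct1, THEN has_field_derivative_at_within] y t in
              \<open>auto simp: has_real_derivative_iff_has_vector_derivative[symmetric]\<close>)
        then show "integral (cbox a b) (\<lambda>x. Qx (x, y, t)) = Q (b, y, t) - Q (a, y, t)"
          by (simp add: integral_unique)
      qed
      also have "\<dots> \<le> integral (cbox c d) (\<lambda>y. \<epsilon> * 2)"
      proof (rule integral_le)
        show "(\<lambda>y. Q (b, y, t) - Q (a, y, t)) integrable_on cbox c d"
          by (intro integrable_continuous continuous_on_diff continuous_on_compose2[OF cont(2)])
            (use t ab in \<open>auto intro!: continuous_intros\<close>)
        show "Q (b, y, t) - Q (a, y, t) \<le> \<epsilon> * 2" if "y \<in> cbox c d" for y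
          using Q[of y t] that t by auto
      qed auto
      finally show ?thesis using cd by (simp add: mult_ac)
    qed
    finally show ?thesis by (simp add: algebra_simps)
  qed
  \<comment> \<open>The bound on \<open>g'\<close> is uniform in time, so its value at one
    intermediate time suffices.\<close>
  have "\<exists>t\<in>{s0<..<s1}. g s1 - g s0 = g' t * (s1 - s0)"
    by (rule mvt_simple[OF s, of g "\<lambda>t h. g' t * h"]) (use der in \<open>auto simp: has_field_derivative_def\<close>)
  then obtain t where t: "t \<in> {s0<..<s1}" "g s1 - g s0 = g' t * (s1 - s0)" by blast
  have "g s1 - g s0 \<le> 2 * \<epsilon> * ((d - c) + (b - a)) * (s1 - s0)"
    unfolding t(2) by (rule mult_right_mono[OF bound]) (use t(1) s in auto)
  moreover have "g s0 \<le> \<epsilon> * ((b - a) * (d - c))"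
  proof -
    have "g s0 \<le> integral ?B (\<lambda>_. \<epsilon>)" unfolding g_def
    proof (rule integral_le)
      show "(\<lambda>z. P (fst z, snd z, s0)) integrable_on ?B"
        using slice[OF cont(1), of s0] s by (auto intro: integrable_continuous)
      show "P (fst z, snd z, s0) \<le> \<epsilon>" if "z \<in> ?B" for z
        using P0[of "fst z" "snd z"] that unfolding B by auto
    qed auto
    then show ?thesis using ab cd by (simp add: content_Pair mult_ac)
  qed
  ultimately show ?thesis unfolding g_def by (simp add: algebra_simps)
qed

subsection \<open>Energy estimate\<close>

text \<open>
  The derivatives are carried along as separate fields: such tuples can be restricted, superposed
  and reflected without recomputing the one-sided derivatives \<open>Dx\<close>, \<open>Dy\<close>, \<open>Dt\<close>. The field \<open>pdt\<close> is at
  once the \<open>t\<close>-derivative of \<open>p\<close> and the \<open>x\<close>-derivative of \<open>r\<close>; likewise \<open>qdt\<close>.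
\<close>

definition wave_hessian ::
  "real \<Rightarrow> real \<Rightarrow> real \<Rightarrow> real \<Rightarrow> field \<Rightarrow> field \<Rightarrow> field \<Rightarrow>
   field \<Rightarrow> field \<Rightarrow> field \<Rightarrow> field \<Rightarrow> field \<Rightarrow> bool" where
  "wave_hessian c T a b p q r pdx qdy rdt pdt qdt \<longleftrightarrow>
     (\<forall>f\<in>{pdx, qdy, rdt, pdt, qdt}. continuous_on ({a<..<b} \<times> {0<..<pi} \<times> {0<..<T}) f) \<and>
     (\<forall>x\<in>{a<..<b}. \<forall>y\<in>{0<..<pi}. \<forall>t\<in>{0<..<T}.
        ((\<lambda>\<xi>. p (\<xi>, y, t)) has_real_derivative pdx (x, y, t)) (at x) \<and>
        ((\<lambda>\<eta>. q (x, \<eta>, t)) has_real_derivative qdy (x, y, t)) (at y) \<and>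
        ((\<lambda>s. r (x, y, s)) has_real_derivative rdt (x, y, t)) (at t) \<and>
        ((\<lambda>s. p (x, y, s)) has_real_derivative pdt (x, y, t)) (at t) \<and>
        ((\<lambda>s. q (x, y, s)) has_real_derivative qdt (x, y, t)) (at t) \<and>
        ((\<lambda>\<xi>. r (\<xi>, y, t)) has_real_derivative pdt (x, y, t)) (at x) \<and>
        ((\<lambda>\<eta>. r (x, \<eta>, t)) has_real_derivative qdt (x, y, t)) (at y) \<and>
        rdt (x, y, t) = c\<^sup>2 * (pdx (x, y, t) + qdy (x, y, t)))"

text \<open>The ranges are chosen by use. Space derivatives include t = 0, so that a zero state has
  zero gradient from the start on. The time derivative reaches the walls, so that a zero Dirichlet
  trace has zero velocity there. At the walls \<open>p\<close> is fixed by continuity from inside,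
  which makes it the Neumann trace.\<close>

definition wave_with_gradient ::
  "real \<Rightarrow> real \<Rightarrow> real \<Rightarrow> real \<Rightarrow> field \<Rightarrow> field \<Rightarrow> field \<Rightarrow> field \<Rightarrow> bool" where
  "wave_with_gradient c T a b v p q r \<longleftrightarrow>
     (\<forall>f\<in>{v, p, q, r}. continuous_on ({a..b} \<times> {0..pi} \<times> {0..<T}) f) \<and>
     (\<forall>x\<in>{a<..<b}. \<forall>y\<in>{0<..<pi}. \<forall>t\<in>{0..<T}.
        ((\<lambda>\<xi>. v (\<xi>, y, t)) has_real_derivative p (x, y, t)) (at x) \<and>
        ((\<lambda>\<eta>. v (x, \<eta>, t)) has_real_derivative q (x, y, t)) (at y)) \<and>
     (\<forall>x\<in>{a..b}. \<forall>y\<in>{0..pi}. \<forall>t\<in>{0<..<T}.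
        ((\<lambda>s. v (x, y, s)) has_real_derivative r (x, y, t)) (at t)) \<and>
     (\<exists>pdx qdy rdt pdt qdt. wave_hessian c T a b p q r pdx qdy rdt pdt qdt) \<and>
     (\<forall>x\<in>{a<..<b}. \<forall>y\<in>{0<..<pi}. v (x, y, 0) = 0 \<and> r (x, y, 0) = 0) \<and>
     (\<forall>x\<in>{a<..<b}. \<forall>t\<in>{0<..<T}. v (x, 0, t) = 0 \<and> v (x, pi, t) = 0)"

lemma wave_hessian_deriv:
  assumes "wave_hessian c T a b p q r pdx qdy rdt pdt qdt"
    and "x \<in> {a<..<b}" "y \<in> {0<..<pi}" "t \<in> {0<..<T}"
  shows "((\<lambda>\<xi>. p (\<xi>, y, t)) has_real_derivative pdx (x, y, t)) (at x)"
    "((\<lambda>\<eta>. q (x, \<eta>, t)) has_real_derivative qdy (x, y, t)) (at y)"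
    "((\<lambda>s. r (x, y, s)) has_real_derivative rdt (x, y, t)) (at t)"
    "((\<lambda>s. p (x, y, s)) has_real_derivative pdt (x, y, t)) (at t)"
    "((\<lambda>s. q (x, y, s)) has_real_derivative qdt (x, y, t)) (at t)"
    "((\<lambda>\<xi>. r (\<xi>, y, t)) has_real_derivative pdt (x, y, t)) (at x)"
    "((\<lambda>\<eta>. r (x, \<eta>, t)) has_real_derivative qdt (x, y, t)) (at y)"
    "rdt (x, y, t) = c\<^sup>2 * (pdx (x, y, t) + qdy (x, y, t))"
  using assms unfolding wave_hessian_def by blast+

lemma has_derivative_zero_unique:
  fixes f :: "real \<Rightarrow> real"
  assumes "(f has_real_derivative d) (at t)" "open S" "t \<in> S" "\<And>s. s \<in> S \<Longrightarrow> f s = 0"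
  shows "d = 0"
  using assms by (metis DERIV_unique DERIV_const has_field_derivative_transform_within_open)

text \<open>This treats Dirichlet walls in the energy estimate: the flux through a wall is a
  multiple of \<open>p * r\<close>, and zero Dirichlet data annihilate \<open>r\<close> just as zero
  Neumann data annihilate \<open>p\<close>.\<close>

lemma wave_velocity_eq_0:
  assumes "wave_with_gradient c T a b v p q r" "x \<in> {a..b}" "y \<in> {0..pi}" "0 \<le> \<alpha>"
    and "\<And>s. s \<in> {\<alpha><..<\<beta>} \<Longrightarrow> v (x, y, s) = 0" "\<beta> \<le> T" "t \<in> {\<alpha><..<\<beta>}"
  shows "r (x, y, t) = 0"
proof (rule has_derivative_zero_unique[of "\<lambda>s. v (x, y, s)" _ t "{\<alpha><..<\<beta>}"])
  show "((\<lambda>s. v (x, y, s)) has_real_derivative r (x, y, t)) (at t)"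
    using assms unfolding wave_with_gradient_def by auto
qed (use assms in auto)

text \<open>By \<open>2 * a * b \<le> a\<^sup>2 + b\<^sup>2\<close>, the energy flux in the
  x-direction is at most \<open>c\<close> times the energy density: energy travels no faster than
  \<open>c\<close>.\<close>

lemma energy_flux_bound:
  fixes c p q r :: real
  assumes "c > 0"
  shows "\<bar>2 * c\<^sup>2 * (p * r)\<bar> \<le> c * (r\<^sup>2 + c\<^sup>2 * (p\<^sup>2 + q\<^sup>2))"
proof -
  have "2 * \<bar>c * p * r\<bar> \<le> (c * p)\<^sup>2 + r\<^sup>2"
    using sum_squares_bound[of "\<bar>c * p\<bar>" "\<bar>r\<bar>"] by (simp add: abs_mult power_mult_distrib mult_ac)
  also have "\<dots> \<le> r\<^sup>2 + c\<^sup>2 * (p\<^sup>2 + q\<^sup>2)" by (simp add: power_mult_distrib algebra_simps)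
  finally have "c * (2 * \<bar>c * p * r\<bar>) \<le> c * (r\<^sup>2 + c\<^sup>2 * (p\<^sup>2 + q\<^sup>2))"
    using assms by (intro mult_left_mono) auto
  then show ?thesis using assms by (simp add: abs_mult power2_eq_square mult_ac)
qed

text \<open>
  Multiplying the wave equation by \<open>2 \<rho> r\<close> gives \<open>\<partial>\<^sub>t (\<rho> e) \<le> div (2 c\<^sup>2 \<rho> r (p, q))\<close> for the
  energy density \<open>e\<close>. Second derivatives exist only in the interior, so this is integrated over slightly
  smaller boxes, whose boundary fluxes tend to zero by uniform continuity.
\<close>

lemma weighted_energy_vanishes:
  fixes \<rho> \<rho>x \<rho>t :: "real \<Rightarrow> real \<Rightarrow> real"
  assumes wave: "wave_with_gradient c T a b v p q r"
    and c: "c > 0" and t0: "0 \<le> t0"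
    and weight_cont: "continuous_on UNIV (\<lambda>z. \<rho> (fst z) (snd z))"
      "continuous_on UNIV (\<lambda>z. \<rho>x (fst z) (snd z))" "continuous_on UNIV (\<lambda>z. \<rho>t (fst z) (snd z))"
    and weight_x: "\<And>x t. ((\<lambda>\<xi>. \<rho> \<xi> t) has_real_derivative \<rho>x x t) (at x)"
    and weight_t: "\<And>x t. ((\<lambda>s. \<rho> x s) has_real_derivative \<rho>t x t) (at t)"
    and weight_nonneg: "\<And>x t. 0 \<le> \<rho> x t" and weight_decay: "\<And>x t. \<rho>t x t + c * \<bar>\<rho>x x t\<bar> \<le> 0"
    and init: "\<And>x y. x \<in> {a<..<b} \<Longrightarrow> y \<in> {0<..<pi} \<Longrightarrow>
      p (x, y, t0) = 0 \<and> q (x, y, t0) = 0 \<and> r (x, y, t0) = 0"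
    and flux: "\<And>y t. y \<in> {0<..<pi} \<Longrightarrow> t \<in> {t0<..<T} \<Longrightarrow>
      \<rho> a t * (p (a, y, t) * r (a, y, t)) = 0 \<and> \<rho> b t * (p (b, y, t) * r (b, y, t)) = 0"
    and pt: "x1 \<in> {a<..<b}" "y1 \<in> {0<..<pi}" "t1 \<in> {t0..<T}" "\<rho> x1 t1 > 0"
  shows "p (x1, y1, t1) = 0 \<and> q (x1, y1, t1) = 0 \<and> r (x1, y1, t1) = 0"
proof (cases "t1 = t0")
  case True
  then show ?thesis using init pt by auto
next
  case False
  then have t01: "t0 < t1" and t1T: "t1 < T" using pt by auto
  let ?I = "{a<..<b} \<times> {0<..<pi} \<times> {0<..<T}"
  let ?K = "{a..b} \<times> {0..pi} \<times> {t0..t1}"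
  obtain pdx qdy rdt pdt qdt where hess: "wave_hessian c T a b p q r pdx qdy rdt pdt qdt"
    using wave unfolding wave_with_gradient_def by blast
  define e where "e z = (r z)\<^sup>2 + c\<^sup>2 * ((p z)\<^sup>2 + (q z)\<^sup>2)" for z
  define P where "P z = \<rho> (fst z) (snd (snd z)) * e z" for z
  define Pt where "Pt z = \<rho>t (fst z) (snd (snd z)) * e z
    + \<rho> (fst z) (snd (snd z)) * (2 * (r z * rdt z + c\<^sup>2 * (p z * pdt z + q z * qdt z)))" for z
  define Q where "Q z = 2 * c\<^sup>2 * (\<rho> (fst z) (snd (snd z)) * (p z * r z))" for z
  define Qx where "Qx z = 2 * c\<^sup>2 * (\<rho>x (fst z) (snd (snd z)) * (p z * r z)
    + \<rho> (fst z) (snd (snd z)) * (pdx z * r z + p z * pdt z))" for z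
  define R where "R z = 2 * c\<^sup>2 * (\<rho> (fst z) (snd (snd z)) * (q z * r z))" for z
  define Ry where "Ry z = 2 * c\<^sup>2 * (\<rho> (fst z) (snd (snd z)) * (qdy z * r z + q z * qdt z))" for z
  have wc: "continuous_on S (\<lambda>z. \<rho> (fst z) (snd (snd z)))" "continuous_on S (\<lambda>z. \<rho>x (fst z) (snd (snd z)))"
    "continuous_on S (\<lambda>z. \<rho>t (fst z) (snd (snd z)))" for S :: "(real \<times> real \<times> real) set"
  proof -
    have "continuous_on S (\<lambda>z. (fst z, snd (snd z)))" by (intro continuous_intros)
    from weight_cont[THEN continuous_on_compose2, OF this] show
      "continuous_on S (\<lambda>z. \<rho> (fst z) (snd (snd z)))" "continuous_on S (\<lambda>z. \<rho>x (fst z) (snd (snd z)))"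
      "continuous_on S (\<lambda>z. \<rho>t (fst z) (snd (snd z)))" by simp_all
  qed
  have c1: "continuous_on S f" if "S \<subseteq> {a..b} \<times> {0..pi} \<times> {0..<T}" "f \<in> {p, q, r}" for S f
    using wave that unfolding wave_with_gradient_def by (auto intro: continuous_on_subset)
  have c2: "continuous_on S f" if "S \<subseteq> ?I" "f \<in> {pdx, qdy, rdt, pdt, qdt}" for S f
    using hess that unfolding wave_hessian_def by (blast intro: continuous_on_subset)
  have contPQR: "continuous_on S P" "continuous_on S Q" "continuous_on S R"
    if "S \<subseteq> {a..b} \<times> {0..pi} \<times> {0..<T}" for S
    using c1[OF that] unfolding P_def Q_def R_def e_def by (auto intro!: continuous_intros wc)
  have contD: "continuous_on S Pt" "continuous_on S Qx" "continuous_on S Ry" if "S \<subseteq> ?I" for S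
  proof -
    have "S \<subseteq> {a..b} \<times> {0..pi} \<times> {0..<T}" using that by fastforce
    then show "continuous_on S Pt" "continuous_on S Qx" "continuous_on S Ry"
      using c1[of S] c2[OF that] unfolding Pt_def Qx_def Ry_def e_def by (auto intro!: continuous_intros wc)
  qed
  have der: "((\<lambda>s. P (x, y, s)) has_real_derivative Pt (x, y, t)) (at t) \<and>
      ((\<lambda>\<xi>. Q (\<xi>, y, t)) has_real_derivative Qx (x, y, t)) (at x) \<and>
      ((\<lambda>\<eta>. R (x, \<eta>, t)) has_real_derivative Ry (x, y, t)) (at y)"
    if "x \<in> {a<..<b}" "y \<in> {0<..<pi}" "t \<in> {0<..<T}" for x y t
  proof -
    note D = wave_hessian_deriv[OF hess that]
    show ?thesis unfolding P_def Pt_def Q_def Qx_def R_def Ry_def e_def fst_conv snd_conv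
      by (intro conjI; (rule derivative_eq_intros weight_x weight_t D(1-7) refl)+)
        (simp_all add: field_simps power2_eq_square)
  qed
  have le: "Pt (x, y, t) \<le> Qx (x, y, t) + Ry (x, y, t)"
    if "x \<in> {a<..<b}" "y \<in> {0<..<pi}" "t \<in> {0<..<T}" for x y t
  proof -
    let ?z = "(x, y, t)"
    have eq: "rdt ?z = c\<^sup>2 * (pdx ?z + qdy ?z)" by (rule wave_hessian_deriv(8)[OF hess that])
    \<comment> \<open>The wave equation cancels all second derivatives; only derivatives of the
      weight survive, and since it does not depend on \<open>y\<close>, only the x-component of the
      flux enters.\<close>
    have "Pt ?z - (Qx ?z + Ry ?z) = \<rho>t x t * e ?z - \<rho>x x t * (2 * c\<^sup>2 * (p ?z * r ?z))"
      unfolding Pt_def Qx_def Ry_def eq by (simp add: algebra_simps)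
    also have "\<dots> \<le> \<rho>t x t * e ?z + \<bar>\<rho>x x t\<bar> * \<bar>2 * c\<^sup>2 * (p ?z * r ?z)\<bar>"
      using abs_ge_minus_self[of "\<rho>x x t * (2 * c\<^sup>2 * (p ?z * r ?z))"] by (simp only: abs_mult)
    also have "\<dots> \<le> \<rho>t x t * e ?z + \<bar>\<rho>x x t\<bar> * (c * e ?z)"
      unfolding e_def by (intro add_left_mono mult_left_mono energy_flux_bound c) auto
    also have "\<dots> = (\<rho>t x t + c * \<bar>\<rho>x x t\<bar>) * e ?z" by (simp add: algebra_simps)
    also have "\<dots> \<le> 0"
      by (rule mult_nonpos_nonneg[OF weight_decay]) (simp add: e_def)
    finally show ?thesis by simp
  qed
  have P_nonneg: "0 \<le> P z" for z unfolding P_def e_def using weight_nonneg by simp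
  have P0: "P (x, y, t0) = 0" if "x \<in> {a<..<b}" "y \<in> {0<..<pi}" for x y
    using init[OF that] by (simp add: P_def e_def)
  have Q0: "Q (a, y, t) = 0" "Q (b, y, t) = 0" if "y \<in> {0<..<pi}" "t \<in> {t0<..<T}" for y t
    using flux[OF that] by (simp_all add: Q_def)
  have R0: "R (x, 0, t) = 0" "R (x, pi, t) = 0" if "x \<in> {a<..<b}" "t \<in> {0<..<T}" for x t
  proof -
    have "v (x, y, s) = 0" if "y \<in> {0, pi}" "s \<in> {0<..<T}" for y s
      using wave that \<open>x \<in> _\<close> unfolding wave_with_gradient_def by blast
    from wave_velocity_eq_0[OF wave _ _ order_refl this order_refl that(2)] that(1)
    show "R (x, 0, t) = 0" "R (x, pi, t) = 0" by (auto simp: R_def)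
  qed
  define m where "m = min (min (x1 - a) (b - x1)) (min y1 (pi - y1))"
  have m: "m > 0" "m \<le> x1 - a" "m \<le> b - x1" "m \<le> y1" "m \<le> pi - y1" using pt by (auto simp: m_def)
  \<comment> \<open>The target box stays fixed and contains the point in question. Since
    \<open>P\<close> is nonnegative, its integral there is bounded by that over any larger box, and
    these may approach the full strip.\<close>
  define \<eta> where "\<eta> = m / 2"
  have \<eta>: "\<eta> > 0" "a + \<eta> < x1" "x1 < b - \<eta>" "\<eta> < y1" "y1 < pi - \<eta>"
    using m unfolding \<eta>_def by linarith+
  let ?B = "cbox (a + \<eta>, \<eta>) (b - \<eta>, pi - \<eta>)"
  let ?J = "integral ?B (\<lambda>z. P (fst z, snd z, t1))"
  have contJ: "continuous_on S (\<lambda>z. P (fst z, snd z, t1))" if "S \<subseteq> {a..b} \<times> {0..pi}" for S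
    by (rule continuous_on_compose2[OF contPQR(1)[OF order_refl]])
      (use that t0 t01 t1T in \<open>auto intro!: continuous_intros\<close>)
  \<comment> \<open>The constant of \<open>integral_box_growth_le\<close> for the full strip; it
    dominates those of all smaller boxes.\<close>
  define M where "M = (b - a) * pi + 2 * (t1 - t0) * (pi + (b - a))"
  have J_le: "?J \<le> \<epsilon> * M" if \<epsilon>: "\<epsilon> > 0" for \<epsilon>
  proof -
    have K: "compact ?K" "?K \<subseteq> {a..b} \<times> {0..pi} \<times> {0..<T}"
      using t0 t1T by (auto intro!: compact_Times)
    have unif: "\<exists>d>0. \<forall>z\<in>?K. \<forall>z'\<in>?K. dist z' z < d \<longrightarrow> dist (F z') (F z) < \<epsilon>"
      if "continuous_on ?K F" for F
      using compact_uniformly_continuous[OF that K(1), unfolded uniformly_continuous_on_def] \<epsilon> by simp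
    obtain dP where dP: "dP > 0"
      "\<And>z z'. z \<in> ?K \<Longrightarrow> z' \<in> ?K \<Longrightarrow> dist z' z < dP \<Longrightarrow> dist (P z') (P z) < \<epsilon>"
      using unif[OF contPQR(1)[OF K(2)]] by blast
    obtain dQ where dQ: "dQ > 0"
      "\<And>z z'. z \<in> ?K \<Longrightarrow> z' \<in> ?K \<Longrightarrow> dist z' z < dQ \<Longrightarrow> dist (Q z') (Q z) < \<epsilon>"
      using unif[OF contPQR(2)[OF K(2)]] by blast
    obtain dR where dR: "dR > 0"
      "\<And>z z'. z \<in> ?K \<Longrightarrow> z' \<in> ?K \<Longrightarrow> dist z' z < dR \<Longrightarrow> dist (R z') (R z) < \<epsilon>"
      using unif[OF contPQR(3)[OF K(2)]] by blast
    define m' where "m' = min (min dP (min dQ dR)) (min \<eta> (t1 - t0))"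
    have m': "m' > 0" "m' \<le> dP" "m' \<le> dQ" "m' \<le> dR" "m' \<le> \<eta>" "m' \<le> t1 - t0"
      using dP(1) dQ(1) dR(1) \<eta>(1) t01 by (auto simp: m'_def)
    define \<delta> where "\<delta> = m' / 2"
    have \<delta>: "\<delta> > 0" "\<delta> < dP" "\<delta> < dQ" "\<delta> < dR" "\<delta> < \<eta>" "\<delta> < t1 - t0"
      using m' unfolding \<delta>_def by linarith+
    let ?B' = "cbox (a + \<delta>, \<delta>) (b - \<delta>, pi - \<delta>)"
    have mem: "x \<in> {a<..<b}" "y \<in> {0<..<pi}" "t \<in> {0<..<T}" "t \<in> {t0<..<T}" "t \<in> {t0..t1}"
      if "x \<in> {a + \<delta>..b - \<delta>}" "y \<in> {\<delta>..pi - \<delta>}" "t \<in> {t0 + \<delta>..t1}" for x y t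
      using that \<delta> t0 t1T by auto
    have sub: "{a + \<delta>..b - \<delta>} \<times> {\<delta>..pi - \<delta>} \<times> {t0 + \<delta>..t1} \<subseteq> ?I" using \<delta> t0 t1T by auto
    then have sub': "{a + \<delta>..b - \<delta>} \<times> {\<delta>..pi - \<delta>} \<times> {t0 + \<delta>..t1} \<subseteq> {a..b} \<times> {0..pi} \<times> {0..<T}" by fastforce
    have "?J \<le> integral ?B' (\<lambda>z. P (fst z, snd z, t1))"
      using \<delta> \<eta> P_nonneg
      by (intro integral_subset_le integrable_continuous contJ) (auto simp: cbox_Pair_eq)
    also have "\<dots> \<le> \<epsilon> * ((b - \<delta> - (a + \<delta>)) * (pi - \<delta> - \<delta>)
        + 2 * (t1 - (t0 + \<delta>)) * ((pi - \<delta> - \<delta>) + (b - \<delta> - (a + \<delta>))))"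
    proof (rule integral_box_growth_le[OF _ _ _ der[OF mem(1-3)] contPQR[OF sub'] contD[OF sub] le[OF mem(1-3)]])
      fix x y assume xy: "x \<in> {a + \<delta>..b - \<delta>}" "y \<in> {\<delta>..pi - \<delta>}"
      show "\<bar>P (x, y, t0 + \<delta>)\<bar> \<le> \<epsilon>"
        using dP(2)[of "(x, y, t0)" "(x, y, t0 + \<delta>)"] P0[of x y] xy \<delta> t01
        by (auto simp: dist_Pair_Pair dist_real_def)
    next
      fix y t assume yt: "y \<in> {\<delta>..pi - \<delta>}" "t \<in> {t0 + \<delta>..t1}"
      show "\<bar>Q (a + \<delta>, y, t)\<bar> \<le> \<epsilon> \<and> \<bar>Q (b - \<delta>, y, t)\<bar> \<le> \<epsilon>"
        using dQ(2)[of "(a, y, t)" "(a + \<delta>, y, t)"] dQ(2)[of "(b, y, t)" "(b - \<delta>, y, t)"] Q0[of y t] yt \<delta> \<eta> t1T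
        by (auto simp: dist_Pair_Pair dist_real_def)
    next
      fix x t assume xt: "x \<in> {a + \<delta>..b - \<delta>}" "t \<in> {t0 + \<delta>..t1}"
      show "\<bar>R (x, \<delta>, t)\<bar> \<le> \<epsilon> \<and> \<bar>R (x, pi - \<delta>, t)\<bar> \<le> \<epsilon>"
        using dR(2)[of "(x, 0, t)" "(x, \<delta>, t)"] dR(2)[of "(x, pi, t)" "(x, pi - \<delta>, t)"] R0[of x t] xt \<delta> \<eta> t1T t0
        by (auto simp: dist_Pair_Pair dist_real_def)
    qed (use \<delta> \<eta> in auto)
    also have "\<dots> \<le> \<epsilon> * M"
      unfolding M_def using \<delta> \<epsilon> \<eta> t01
      by (intro mult_left_mono add_mono mult_mono) auto
    finally show ?thesis .
  qed
  have M: "M > 0" unfolding M_def using t01 pt by (auto intro!: add_pos_pos)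
  have "?J \<le> 0"
  proof (rule field_le_epsilon)
    fix \<epsilon> :: real assume "\<epsilon> > 0"
    then show "?J \<le> 0 + \<epsilon>" using J_le[of "\<epsilon> / M"] M by simp
  qed
  moreover have contB: "continuous_on ?B (\<lambda>z. P (fst z, snd z, t1))"
    using \<eta> by (intro contJ) (auto simp: cbox_Pair_eq)
  moreover have "?J \<ge> 0"
    by (rule integral_nonneg[OF integrable_continuous[OF contB] P_nonneg])
  ultimately have J0: "?J = 0" by simp
  have "P (fst (x1, y1), snd (x1, y1), t1) = 0"
  proof (rule has_integral_0_cbox_imp_0[OF contB P_nonneg])
    show "((\<lambda>z. P (fst z, snd z, t1)) has_integral 0) ?B"
      using integrable_integral[OF integrable_continuous[OF contB]] J0 by simp
    show "box (a + \<eta>, \<eta>) (b - \<eta>, pi - \<eta>) \<noteq> {}" using \<eta> by (auto simp: box_ne_empty Basis_prod_def)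
    show "(x1, y1) \<in> ?B" using \<eta> by (auto simp: cbox_Pair_eq)
  qed
  then have "e (x1, y1, t1) = 0" using pt(4) by (simp add: P_def)
  then have "(r (x1, y1, t1))\<^sup>2 + c\<^sup>2 * ((p (x1, y1, t1))\<^sup>2 + (q (x1, y1, t1))\<^sup>2) = 0" by (simp add: e_def)
  then show ?thesis using c by (simp add: add_nonneg_eq_0_iff)
qed

subsection \<open>Restriction, superposition and reflection\<close>

lemma wave_with_gradientD:
  assumes "wave_with_gradient c T a b v p q r"
  shows "f \<in> {v, p, q, r} \<Longrightarrow> continuous_on ({a..b} \<times> {0..pi} \<times> {0..<T}) f"
    and "x \<in> {a<..<b} \<Longrightarrow> y \<in> {0<..<pi} \<Longrightarrow> t \<in> {0..<T} \<Longrightarrow>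
      ((\<lambda>\<xi>. v (\<xi>, y, t)) has_real_derivative p (x, y, t)) (at x)"
    and "x \<in> {a<..<b} \<Longrightarrow> y \<in> {0<..<pi} \<Longrightarrow> t \<in> {0..<T} \<Longrightarrow>
      ((\<lambda>\<eta>. v (x, \<eta>, t)) has_real_derivative q (x, y, t)) (at y)"
    and "x \<in> {a..b} \<Longrightarrow> y \<in> {0..pi} \<Longrightarrow> t \<in> {0<..<T} \<Longrightarrow>
      ((\<lambda>s. v (x, y, s)) has_real_derivative r (x, y, t)) (at t)"
    and "\<exists>pdx qdy rdt pdt qdt. wave_hessian c T a b p q r pdx qdy rdt pdt qdt"
    and "x \<in> {a<..<b} \<Longrightarrow> y \<in> {0<..<pi} \<Longrightarrow> v (x, y, 0) = 0 \<and> r (x, y, 0) = 0"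
    and "x \<in> {a<..<b} \<Longrightarrow> t \<in> {0<..<T} \<Longrightarrow> v (x, 0, t) = 0 \<and> v (x, pi, t) = 0"
  using assms unfolding wave_with_gradient_def by blast+

lemma wave_restrict:
  assumes wave: "wave_with_gradient c T a b v p q r" and "a \<le> a'" "b' \<le> b" "T' \<le> T"
  shows "wave_with_gradient c T' a' b' v p q r"
proof -
  note D = wave_with_gradientD[OF wave]
  obtain pdx qdy rdt pdt qdt where H: "wave_hessian c T a b p q r pdx qdy rdt pdt qdt" using D(5) by blast
  have "{a'<..<b'} \<times> {0<..<pi} \<times> {0<..<T'} \<subseteq> {a<..<b} \<times> {0<..<pi} \<times> {0<..<T}"
    using assms by auto
  then have "wave_hessian c T' a' b' p q r pdx qdy rdt pdt qdt"
    unfolding wave_hessian_def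
  proof (intro conjI ballI)
    fix f assume "f \<in> {pdx, qdy, rdt, pdt, qdt}"
    then show "continuous_on ({a'<..<b'} \<times> {0<..<pi} \<times> {0<..<T'}) f"
      using H \<open>_ \<subseteq> _\<close> unfolding wave_hessian_def by (blast intro: continuous_on_subset)
  qed (rule wave_hessian_deriv[OF H]; use assms(2-) in auto)+
  moreover have "{a'..b'} \<times> {0..pi} \<times> {0..<T'} \<subseteq> {a..b} \<times> {0..pi} \<times> {0..<T}"
    using assms by auto
  then have "\<forall>f\<in>{v, p, q, r}. continuous_on ({a'..b'} \<times> {0..pi} \<times> {0..<T'}) f"
    using D(1) continuous_on_subset by blast
  ultimately show ?thesis
    unfolding wave_with_gradient_def
    using D(2-4,6,7) assms(2-) by (intro conjI) (blast | auto)+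
qed

lemma wave_combine:
  assumes wave: "wave_with_gradient c T a b v p q r" "wave_with_gradient c T a b v' p' q' r'"
  shows "wave_with_gradient c T a b (\<lambda>z. \<alpha> * v z + \<beta> * v' z) (\<lambda>z. \<alpha> * p z + \<beta> * p' z)
    (\<lambda>z. \<alpha> * q z + \<beta> * q' z) (\<lambda>z. \<alpha> * r z + \<beta> * r' z)"
proof -
  note D = wave_with_gradientD[OF wave(1)] and D' = wave_with_gradientD[OF wave(2)]
  obtain pdx qdy rdt pdt qdt where H: "wave_hessian c T a b p q r pdx qdy rdt pdt qdt" using D(5) by blast
  obtain pdx' qdy' rdt' pdt' qdt' where H': "wave_hessian c T a b p' q' r' pdx' qdy' rdt' pdt' qdt'"
    using D'(5) by blast
  have "wave_hessian c T a b (\<lambda>z. \<alpha> * p z + \<beta> * p' z) (\<lambda>z. \<alpha> * q z + \<beta> * q' z) (\<lambda>z. \<alpha> * r z + \<beta> * r' z)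
    (\<lambda>z. \<alpha> * pdx z + \<beta> * pdx' z) (\<lambda>z. \<alpha> * qdy z + \<beta> * qdy' z) (\<lambda>z. \<alpha> * rdt z + \<beta> * rdt' z)
    (\<lambda>z. \<alpha> * pdt z + \<beta> * pdt' z) (\<lambda>z. \<alpha> * qdt z + \<beta> * qdt' z)"
    unfolding wave_hessian_def
  proof (intro conjI ballI)
    fix f assume "f \<in> {\<lambda>z. \<alpha> * pdx z + \<beta> * pdx' z, \<lambda>z. \<alpha> * qdy z + \<beta> * qdy' z, \<lambda>z. \<alpha> * rdt z + \<beta> * rdt' z,
      \<lambda>z. \<alpha> * pdt z + \<beta> * pdt' z, \<lambda>z. \<alpha> * qdt z + \<beta> * qdt' z}"
    then show "continuous_on ({a<..<b} \<times> {0<..<pi} \<times> {0<..<T}) f"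
      using H H' unfolding wave_hessian_def by (auto intro!: continuous_intros)
  qed (auto intro!: derivative_eq_intros wave_hessian_deriv(1-7)[OF H] wave_hessian_deriv(1-7)[OF H']
      simp: wave_hessian_deriv(8)[OF H] wave_hessian_deriv(8)[OF H'] algebra_simps)
  then have "\<exists>pdx qdy rdt pdt qdt. wave_hessian c T a b (\<lambda>z. \<alpha> * p z + \<beta> * p' z)
      (\<lambda>z. \<alpha> * q z + \<beta> * q' z) (\<lambda>z. \<alpha> * r z + \<beta> * r' z) pdx qdy rdt pdt qdt" by blast
  moreover have "\<forall>f\<in>{\<lambda>z. \<alpha> * v z + \<beta> * v' z, \<lambda>z. \<alpha> * p z + \<beta> * p' z, \<lambda>z. \<alpha> * q z + \<beta> * q' z,
      \<lambda>z. \<alpha> * r z + \<beta> * r' z}. continuous_on ({a..b} \<times> {0..pi} \<times> {0..<T}) f"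
    using D(1) D'(1) by (auto intro!: continuous_intros)
  ultimately show ?thesis
    unfolding wave_with_gradient_def using D(6,7) D'(6,7)
    by (intro conjI) (assumption | auto intro!: derivative_eq_intros D(2-4) D'(2-4))+
qed

text \<open>The wave equation is even in \<open>x\<close>, so only the fields with one x-derivative,
  \<open>p\<close> and \<open>pdt\<close>, change sign. With \<open>m\<close> twice the position of
  an interface, this folds one neighbour onto the other.\<close>

lemma wave_reflect:
  assumes wave: "wave_with_gradient c T a b v p q r"
  shows "wave_with_gradient c T (m - b) (m - a) (\<lambda>z. v (m - fst z, snd z)) (\<lambda>z. - p (m - fst z, snd z))
    (\<lambda>z. q (m - fst z, snd z)) (\<lambda>z. r (m - fst z, snd z))"
proof -
  note D = wave_with_gradientD[OF wave]
  obtain pdx qdy rdt pdt qdt where H: "wave_hessian c T a b p q r pdx qdy rdt pdt qdt" using D(5) by blast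
  have cont: "continuous_on ({m - b<..<m - a} \<times> S) (\<lambda>z. f (m - fst z, snd z))"
    if "continuous_on ({a<..<b} \<times> S) f" for f :: field and S
    by (rule continuous_on_compose2[OF that]) (auto intro!: continuous_intros)
  have cont': "continuous_on ({m - b..m - a} \<times> S) (\<lambda>z. f (m - fst z, snd z))"
    if "continuous_on ({a..b} \<times> S) f" for f :: field and S
    by (rule continuous_on_compose2[OF that]) (auto intro!: continuous_intros)
  have refl: "((\<lambda>\<xi>. f (m - \<xi>, y, t)) has_real_derivative - d) (at x)"
    if "((\<lambda>\<xi>. f (\<xi>, y, t)) has_real_derivative d) (at (m - x))" for f :: field and d x y t
  proof -
    have "((\<lambda>\<xi>. m - \<xi>) has_real_derivative -1) (at x)" by (auto intro!: derivative_eq_intros)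
    from DERIV_chain2[where f="\<lambda>\<xi>. f (\<xi>, y, t)" and g="\<lambda>\<xi>. m - \<xi>" and Db="-1", OF that this]
    show ?thesis by simp
  qed
  have "wave_hessian c T (m - b) (m - a) (\<lambda>z. - p (m - fst z, snd z)) (\<lambda>z. q (m - fst z, snd z))
    (\<lambda>z. r (m - fst z, snd z)) (\<lambda>z. pdx (m - fst z, snd z)) (\<lambda>z. qdy (m - fst z, snd z))
    (\<lambda>z. rdt (m - fst z, snd z)) (\<lambda>z. - pdt (m - fst z, snd z)) (\<lambda>z. qdt (m - fst z, snd z))"
    unfolding wave_hessian_def
  proof (intro conjI ballI)
    fix f assume "f \<in> {\<lambda>z. pdx (m - fst z, snd z), \<lambda>z. qdy (m - fst z, snd z), \<lambda>z. rdt (m - fst z, snd z),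
      \<lambda>z. - pdt (m - fst z, snd z), \<lambda>z. qdt (m - fst z, snd z)}"
    then show "continuous_on ({m - b<..<m - a} \<times> {0<..<pi} \<times> {0<..<T}) f"
      using H unfolding wave_hessian_def by (auto intro!: cont continuous_on_minus)
  next
    fix x y t :: real
    assume xyt: "x \<in> {m - b<..<m - a}" "y \<in> {0<..<pi}" "t \<in> {0<..<T}"
    then have "m - x \<in> {a<..<b}" by auto
    note H' = wave_hessian_deriv[OF H this xyt(2,3)]
    show "((\<lambda>\<xi>. - p (m - fst (\<xi>, y, t), snd (\<xi>, y, t))) has_real_derivative
        pdx (m - fst (x, y, t), snd (x, y, t))) (at x)"
      using DERIV_minus[OF refl[OF H'(1)]] by simp
  qed (simp only: fst_conv snd_conv,
      rule wave_hessian_deriv(2,3,5,7,8)[OF H] DERIV_minus[OF wave_hessian_deriv(4)[OF H]]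
        refl[OF wave_hessian_deriv(6)[OF H]]; auto)+
  then have "\<exists>pdx qdy rdt pdt qdt. wave_hessian c T (m - b) (m - a) (\<lambda>z. - p (m - fst z, snd z))
      (\<lambda>z. q (m - fst z, snd z)) (\<lambda>z. r (m - fst z, snd z)) pdx qdy rdt pdt qdt" by blast
  moreover have "\<forall>f\<in>{\<lambda>z. v (m - fst z, snd z), \<lambda>z. - p (m - fst z, snd z), \<lambda>z. q (m - fst z, snd z),
      \<lambda>z. r (m - fst z, snd z)}. continuous_on ({m - b..m - a} \<times> {0..pi} \<times> {0..<T}) f"
    using D(1) by (auto intro!: cont' continuous_on_minus)
  ultimately show ?thesis
    unfolding wave_with_gradient_def using D(6,7)
    by (intro conjI) (assumption | auto intro!: refl D(2-4))+
qed

subsection \<open>Classical solutions\<close>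

lemma C1_on_derivs:
  assumes "C1_on X Y S v" "x \<in> X" "y \<in> Y" "t \<in> S"
  shows "((\<lambda>\<xi>. v (\<xi>, y, t)) has_real_derivative Dx X v (x, y, t)) (at x within X)"
    "((\<lambda>\<eta>. v (x, \<eta>, t)) has_real_derivative Dy Y v (x, y, t)) (at y within Y)"
    "((\<lambda>s. v (x, y, s)) has_real_derivative Dt S v (x, y, t)) (at t within S)"
  using assms unfolding C1_on_def Dx_def Dy_def Dt_def has_real_derivative_iff_has_vector_derivative
  by (auto simp: vector_derivative_works[symmetric])

lemma C1_on_open_derivs:
  assumes "C1_on X Y S v" "x \<in> X" "y \<in> Y" "t \<in> S" "open X" "open Y" "open S"
  shows "((\<lambda>\<xi>. v (\<xi>, y, t)) has_real_derivative Dx X v (x, y, t)) (at x)"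
    "((\<lambda>\<eta>. v (x, \<eta>, t)) has_real_derivative Dy Y v (x, y, t)) (at y)"
    "((\<lambda>s. v (x, y, s)) has_real_derivative Dt S v (x, y, t)) (at t)"
  using C1_on_derivs[OF assms(1-4)]
    at_within_open[OF assms(2,5)] at_within_open[OF assms(3,6)] at_within_open[OF assms(4,7)] by simp_all

text \<open>The derivatives within the closed intervals serve as gradient because they carry the
  boundary traces. In the open domain they agree with the interior derivatives, which are
  differentiable once more, and \<open>mixed_partials_eq\<close> merges the mixed ones.\<close>

lemma wave_solution_gradient:
  assumes sol: "wave_solution c T a b v"
  shows "wave_with_gradient c T a b v (Dx {a..b} v) (Dy {0..pi} v) (Dt {0..<T} v)"
proof -
  let ?X = "{a<..<b}" and ?Y = "{0<..<pi}" and ?S = "{0<..<T}"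
  let ?p = "Dx ?X v" and ?q = "Dy ?Y v" and ?r = "Dt ?S v"
  have C1: "C1_on {a..b} {0..pi} {0..<T} v" and C1v: "C1_on ?X ?Y ?S v"
    and C1p: "C1_on ?X ?Y ?S ?p" and C1q: "C1_on ?X ?Y ?S ?q" and C1r: "C1_on ?X ?Y ?S ?r"
    and eq: "\<And>x y t. x \<in> ?X \<Longrightarrow> y \<in> ?Y \<Longrightarrow> t \<in> ?S \<Longrightarrow>
      Dt ?S ?r (x, y, t) = c\<^sup>2 * (Dx ?X ?p (x, y, t) + Dy ?Y ?q (x, y, t))"
    using sol unfolding wave_solution_def C2_on_def by auto
  have int: "at x within {a..b} = at x" "at x within ?X = at x" if "x \<in> ?X" for x
    using that by (auto intro!: at_within_interior at_within_open)
  have inty: "at y within {0..pi} = at y" "at y within ?Y = at y" if "y \<in> ?Y" for y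
    using that by (auto intro!: at_within_interior at_within_open)
  have "?S \<subseteq> interior {0..<T}" by (rule interior_maximal) auto
  then have intt: "at t within {0..<T} = at t" "at t within ?S = at t" if "t \<in> ?S" for t
    using that by (auto intro!: at_within_interior at_within_open)
  have p_eq: "Dx {a..b} v (x, y, t) = ?p (x, y, t)" if "x \<in> ?X" for x y t
    using int[OF that] by (simp add: Dx_def)
  have q_eq: "Dy {0..pi} v (x, y, t) = ?q (x, y, t)" if "y \<in> ?Y" for x y t
    using inty[OF that] by (simp add: Dy_def)
  have r_eq: "Dt {0..<T} v (x, y, t) = ?r (x, y, t)" if "t \<in> ?S" for x y t
    using intt[OF that] by (simp add: Dt_def)
  note opn = open_greaterThanLessThan[of a b] open_greaterThanLessThan[of 0 pi] open_greaterThanLessThan[of 0 T]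
  note d = C1_on_open_derivs[OF C1v _ _ _ opn] and dp = C1_on_open_derivs[OF C1p _ _ _ opn]
    and dq = C1_on_open_derivs[OF C1q _ _ _ opn] and dr = C1_on_open_derivs[OF C1r _ _ _ opn]
  have mixed_x: "Dt ?S ?p (x, y, t) = Dx ?X ?r (x, y, t)" if "x \<in> ?X" "y \<in> ?Y" "t \<in> ?S" for x y t
  proof -
    let ?\<sigma> = "\<lambda>z. (fst z, y, snd z)"
    have cont: "continuous_on (?X \<times> ?S) (\<lambda>z. f (?\<sigma> z))" if "continuous_on (?X \<times> ?Y \<times> ?S) f" for f :: field
      by (rule continuous_on_compose2[OF that]) (use \<open>y \<in> ?Y\<close> in \<open>auto intro!: continuous_intros\<close>)
    have "(\<lambda>z. Dt ?S ?p (?\<sigma> z)) (x, t) = (\<lambda>z. Dx ?X ?r (?\<sigma> z)) (x, t)"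
      by (rule mixed_partials_eq[where X="?X" and S="?S" and f="\<lambda>z. v (?\<sigma> z)" and fx="\<lambda>z. ?p (?\<sigma> z)"
          and ft="\<lambda>z. ?r (?\<sigma> z)" and fxt="\<lambda>z. Dt ?S ?p (?\<sigma> z)" and ftx="\<lambda>z. Dx ?X ?r (?\<sigma> z)"])
        (use that C1p C1r in \<open>simp_all add: d(1,3) dp(3) dr(1) cont C1_on_def\<close>)
    then show ?thesis by simp
  qed
  have mixed_y: "Dt ?S ?q (x, y, t) = Dy ?Y ?r (x, y, t)" if "x \<in> ?X" "y \<in> ?Y" "t \<in> ?S" for x y t
  proof -
    let ?\<sigma> = "\<lambda>z. (x, z)"
    have cont: "continuous_on (?Y \<times> ?S) (\<lambda>z. f (?\<sigma> z))" if "continuous_on (?X \<times> ?Y \<times> ?S) f" for f :: field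
      by (rule continuous_on_compose2[OF that]) (use \<open>x \<in> ?X\<close> in \<open>auto intro!: continuous_intros\<close>)
    have "(\<lambda>z. Dt ?S ?q (?\<sigma> z)) (y, t) = (\<lambda>z. Dy ?Y ?r (?\<sigma> z)) (y, t)"
      by (rule mixed_partials_eq[where X="?Y" and S="?S" and f="\<lambda>z. v (?\<sigma> z)" and fx="\<lambda>z. ?q (?\<sigma> z)"
          and ft="\<lambda>z. ?r (?\<sigma> z)" and fxt="\<lambda>z. Dt ?S ?q (?\<sigma> z)" and ftx="\<lambda>z. Dy ?Y ?r (?\<sigma> z)"])
        (use that C1q C1r in \<open>simp_all add: d(2,3) dq(3) dr(2) cont C1_on_def\<close>)
    then show ?thesis by simp
  qed
  have "wave_hessian c T a b (Dx {a..b} v) (Dy {0..pi} v) (Dt {0..<T} v)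
    (Dx ?X ?p) (Dy ?Y ?q) (Dt ?S ?r) (Dt ?S ?p) (Dt ?S ?q)"
    unfolding wave_hessian_def
  proof (intro conjI ballI)
    fix f assume "f \<in> {Dx ?X ?p, Dy ?Y ?q, Dt ?S ?r, Dt ?S ?p, Dt ?S ?q}"
    then show "continuous_on (?X \<times> ?Y \<times> ?S) f" using C1p C1q C1r unfolding C1_on_def by blast
  next
    fix x y t assume xyt: "x \<in> ?X" "y \<in> ?Y" "t \<in> ?S"
    note dp = dp[OF xyt] and dq = dq[OF xyt] and dr = dr[OF xyt]
    note tr = has_field_derivative_transform_within_open
    show "((\<lambda>\<xi>. Dx {a..b} v (\<xi>, y, t)) has_real_derivative Dx ?X ?p (x, y, t)) (at x)"
      by (rule tr[OF dp(1) open_greaterThanLessThan xyt(1)]) (simp add: p_eq)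
    show "((\<lambda>s. Dx {a..b} v (x, y, s)) has_real_derivative Dt ?S ?p (x, y, t)) (at t)"
      by (rule tr[OF dp(3) open_greaterThanLessThan xyt(3)]) (use xyt in \<open>simp add: p_eq\<close>)
    show "((\<lambda>\<eta>. Dy {0..pi} v (x, \<eta>, t)) has_real_derivative Dy ?Y ?q (x, y, t)) (at y)"
      by (rule tr[OF dq(2) open_greaterThanLessThan xyt(2)]) (simp add: q_eq)
    show "((\<lambda>s. Dy {0..pi} v (x, y, s)) has_real_derivative Dt ?S ?q (x, y, t)) (at t)"
      by (rule tr[OF dq(3) open_greaterThanLessThan xyt(3)]) (use xyt in \<open>simp add: q_eq\<close>)
    show "((\<lambda>s. Dt {0..<T} v (x, y, s)) has_real_derivative Dt ?S ?r (x, y, t)) (at t)"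
      by (rule tr[OF dr(3) open_greaterThanLessThan xyt(3)]) (simp add: r_eq)
    show "((\<lambda>\<xi>. Dt {0..<T} v (\<xi>, y, t)) has_real_derivative Dt ?S ?p (x, y, t)) (at x)"
      unfolding mixed_x[OF xyt]
      by (rule tr[OF dr(1) open_greaterThanLessThan xyt(1)]) (use xyt in \<open>simp add: r_eq\<close>)
    show "((\<lambda>\<eta>. Dt {0..<T} v (x, \<eta>, t)) has_real_derivative Dt ?S ?q (x, y, t)) (at y)"
      unfolding mixed_y[OF xyt]
      by (rule tr[OF dr(2) open_greaterThanLessThan xyt(2)]) (use xyt in \<open>simp add: r_eq\<close>)
    show "Dt ?S ?r (x, y, t) = c\<^sup>2 * (Dx ?X ?p (x, y, t) + Dy ?Y ?q (x, y, t))" by (rule eq[OF xyt])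
  qed
  then have "\<exists>pdx qdy rdt pdt qdt. wave_hessian c T a b (Dx {a..b} v) (Dy {0..pi} v) (Dt {0..<T} v)
      pdx qdy rdt pdt qdt" by blast
  moreover have "\<forall>f\<in>{v, Dx {a..b} v, Dy {0..pi} v, Dt {0..<T} v}. continuous_on ({a..b} \<times> {0..pi} \<times> {0..<T}) f"
    using C1 unfolding C1_on_def by blast
  moreover have "\<forall>x\<in>?X. \<forall>y\<in>?Y. \<forall>t\<in>{0..<T}.
      ((\<lambda>\<xi>. v (\<xi>, y, t)) has_real_derivative Dx {a..b} v (x, y, t)) (at x) \<and>
      ((\<lambda>\<eta>. v (x, \<eta>, t)) has_real_derivative Dy {0..pi} v (x, y, t)) (at y)"
  proof (intro ballI)
    fix x y t assume xyt: "x \<in> ?X" "y \<in> ?Y" "t \<in> {0..<T}"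
    then have "x \<in> {a..b}" "y \<in> {0..pi}" by auto
    from C1_on_derivs(1,2)[OF C1 this xyt(3)] show
      "((\<lambda>\<xi>. v (\<xi>, y, t)) has_real_derivative Dx {a..b} v (x, y, t)) (at x) \<and>
      ((\<lambda>\<eta>. v (x, \<eta>, t)) has_real_derivative Dy {0..pi} v (x, y, t)) (at y)"
      using int[OF xyt(1)] inty[OF xyt(2)] by simp
  qed
  moreover have "\<forall>x\<in>{a..b}. \<forall>y\<in>{0..pi}. \<forall>t\<in>?S.
      ((\<lambda>s. v (x, y, s)) has_real_derivative Dt {0..<T} v (x, y, t)) (at t)"
  proof (intro ballI)
    fix x y t assume xyt: "x \<in> {a..b}" "y \<in> {0..pi}" "t \<in> ?S"
    then have "t \<in> {0..<T}" by simp
    from C1_on_derivs(3)[OF C1 xyt(1,2) this] show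
      "((\<lambda>s. v (x, y, s)) has_real_derivative Dt {0..<T} v (x, y, t)) (at t)"
      by (simp only: intt(1)[OF xyt(3)])
  qed
  moreover have "\<forall>x\<in>?X. \<forall>y\<in>?Y. v (x, y, 0) = 0 \<and> Dt {0..<T} v (x, y, 0) = 0"
    and "\<forall>x\<in>?X. \<forall>t\<in>?S. v (x, 0, t) = 0 \<and> v (x, pi, t) = 0"
    using sol unfolding wave_solution_def by simp_all
  ultimately show ?thesis
    unfolding wave_with_gradient_def by (intro conjI) assumption+
qed

text \<open>Any time up to which the solution vanished can serve as a new initial time. Continuity
  carries \<open>v = 0\<close> and \<open>r = 0\<close> to \<open>t0\<close> itself, or the initial
  data do so if \<open>t0 = 0\<close>; then \<open>p\<close> and \<open>q\<close> are space
  derivatives of a zero function.\<close>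

lemma wave_rest_state:
  assumes wave: "wave_with_gradient c T a b v p q r" and t0: "0 \<le> t0" "t0 < T"
    and zero: "\<And>x y t. x \<in> {a<..<b} \<Longrightarrow> y \<in> {0<..<pi} \<Longrightarrow> t \<in> {0<..<t0} \<Longrightarrow> v (x, y, t) = 0"
    and xy: "x \<in> {a<..<b}" "y \<in> {0<..<pi}"
  shows "v (x, y, t0) = 0" "p (x, y, t0) = 0" "q (x, y, t0) = 0" "r (x, y, t0) = 0"
proof -
  note D = wave_with_gradientD[OF wave]
  have vr: "v (x, y, t0) = 0 \<and> r (x, y, t0) = 0" if xy: "x \<in> {a<..<b}" "y \<in> {0<..<pi}" for x y
  proof (cases "t0 = 0")
    case True
    then show ?thesis using D(6)[OF xy] by simp
  next
    case False
    then have cl: "closure {0<..<t0} = {0..t0}" using t0 by simp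
    have r0: "r (x, y, s) = 0" if "s \<in> {0<..<t0}" for s
      by (rule wave_velocity_eq_0[OF wave, where \<alpha> = 0 and \<beta> = t0]) (use zero that xy t0 in auto)
    have cont: "continuous_on (closure {0<..<t0}) (\<lambda>s. f (x, y, s))" if "f \<in> {v, p, q, r}" for f
      unfolding cl by (rule continuous_on_compose2[OF D(1)[OF that]])
        (use xy t0 in \<open>auto intro!: continuous_intros\<close>)
    have "t0 \<in> closure {0<..<t0}" using cl t0 by simp
    then show ?thesis
      using continuous_constant_on_closure[OF cont, of v 0 t0] continuous_constant_on_closure[OF cont, of r 0 t0]
        zero[OF xy] r0 by blast
  qed
  have t: "t0 \<in> {0..<T}" using t0 by simp
  show "v (x, y, t0) = 0" "r (x, y, t0) = 0" using vr[OF xy] by auto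
  show "p (x, y, t0) = 0"
    by (rule has_derivative_zero_unique[OF D(2)[OF xy t] open_greaterThanLessThan xy(1)]) (use vr xy in auto)
  show "q (x, y, t0) = 0"
    by (rule has_derivative_zero_unique[OF D(3)[OF xy t] open_greaterThanLessThan xy(2)]) (use vr xy in auto)
qed

text \<open>The energy controls only the gradient; \<open>v\<close> is recovered from
  \<open>r = 0\<close> along the time segment from \<open>t0\<close> to \<open>t1\<close>. The whole
  segment lies where the weight is positive, since the decay condition makes the weight
  nonincreasing in time.\<close>

lemma weighted_energy_solution_vanishes:
  fixes \<rho> \<rho>x \<rho>t :: "real \<Rightarrow> real \<Rightarrow> real"
  assumes wave: "wave_with_gradient c T a b v p q r"
    and c: "c > 0" and t0: "0 \<le> t0"
    and weight_cont: "continuous_on UNIV (\<lambda>z. \<rho> (fst z) (snd z))"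
      "continuous_on UNIV (\<lambda>z. \<rho>x (fst z) (snd z))" "continuous_on UNIV (\<lambda>z. \<rho>t (fst z) (snd z))"
    and weight_x: "\<And>x t. ((\<lambda>\<xi>. \<rho> \<xi> t) has_real_derivative \<rho>x x t) (at x)"
    and weight_t: "\<And>x t. ((\<lambda>s. \<rho> x s) has_real_derivative \<rho>t x t) (at t)"
    and weight_nonneg: "\<And>x t. 0 \<le> \<rho> x t" and weight_decay: "\<And>x t. \<rho>t x t + c * \<bar>\<rho>x x t\<bar> \<le> 0"
    and zero: "\<And>x y t. x \<in> {a<..<b} \<Longrightarrow> y \<in> {0<..<pi} \<Longrightarrow> t \<in> {0<..<t0} \<Longrightarrow> v (x, y, t) = 0"
    and flux: "\<And>y t. y \<in> {0<..<pi} \<Longrightarrow> t \<in> {t0<..<T} \<Longrightarrow>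
      \<rho> a t * (p (a, y, t) * r (a, y, t)) = 0 \<and> \<rho> b t * (p (b, y, t) * r (b, y, t)) = 0"
    and pt: "x1 \<in> {a<..<b}" "y1 \<in> {0<..<pi}" "t1 \<in> {t0..<T}" "\<rho> x1 t1 > 0"
  shows "v (x1, y1, t1) = 0" "p (x1, y1, t1) = 0"
proof -
  note D = wave_with_gradientD[OF wave]
  have t0T: "t0 < T" using pt by auto
  note rest = wave_rest_state[OF wave t0 t0T zero]
  note energy = weighted_energy_vanishes[OF wave c t0 weight_cont weight_x weight_t weight_nonneg weight_decay]
  have init: "p (x, y, t0) = 0 \<and> q (x, y, t0) = 0 \<and> r (x, y, t0) = 0" if "x \<in> {a<..<b}" "y \<in> {0<..<pi}" for x y
    using rest(2-4)[OF _ _ _ that] by simp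
  show "p (x1, y1, t1) = 0" using energy[OF init flux pt] by simp
  have r0: "r (x1, y1, s) = 0" if "s \<in> {t0..t1}" for s
  proof -
    have "\<rho> x1 t1 \<le> \<rho> x1 s"
    proof (rule DERIV_nonpos_imp_nonincreasing[where f="\<lambda>s. \<rho> x1 s"])
      show "s \<le> t1" using that by simp
      have "\<rho>t x1 t \<le> 0" for t using weight_decay[of x1 t] mult_nonneg_nonneg[OF less_imp_le[OF c] abs_ge_zero[of "\<rho>x x1 t"]] by linarith
      then show "\<exists>y. ((\<lambda>s. \<rho> x1 s) has_real_derivative y) (at t) \<and> y \<le> 0" for t using weight_t by blast
    qed
    then show ?thesis using energy[OF init flux pt(1,2), of s] that pt(3,4) by auto
  qed
  show "v (x1, y1, t1) = 0"
  proof (cases "t0 = t1")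
    case True
    then show ?thesis using rest(1)[OF _ _ _ pt(1,2)] by simp
  next
    case False
    then have lt: "t0 < t1" using pt by simp
    have "continuous_on {t0..t1} (\<lambda>s. v (x1, y1, s))"
      by (rule continuous_on_compose2[OF D(1)[of v]]) (use pt t0 in \<open>auto intro!: continuous_intros\<close>)
    then have "v (x1, y1, t1) = v (x1, y1, t0)"
    proof (rule DERIV_isconst_end[OF lt])
      fix s assume s: "t0 < s" "s < t1"
      then show "((\<lambda>s. v (x1, y1, s)) has_real_derivative 0) (at s)"
        using D(4)[of x1 y1 s] r0[of s] pt t0 by auto
    qed
    then show ?thesis using rest(1)[OF _ _ _ pt(1,2)] by simp
  qed
qed

subsection \<open>Finite speed of propagation\<close>

text \<open>The weight has to be continuously differentiable and vanish on a half-line. The positive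
  part has a kink at 0, but its square does not.\<close>

lemma has_derivative_max_0_sq:
  fixes x :: real
  shows "((\<lambda>x. (max 0 x)\<^sup>2) has_real_derivative 2 * max 0 x) (at x)"
proof -
  consider "x < 0" | "x = 0" | "x > 0" by linarith
  then show ?thesis
  proof cases
    case 1
    have "((\<lambda>x. 0) has_real_derivative 2 * max 0 x) (at x)" using 1 by simp
    then show ?thesis by (rule has_field_derivative_transform_within_open[of _ _ _ "{..<0}"]) (use 1 in auto)
  next
    case 2
    have "((\<lambda>h. (max 0 h)\<^sup>2 / h) \<longlongrightarrow> (0::real)) (at 0)"
    proof (rule Lim_null_comparison)
      show "\<forall>\<^sub>F h in at 0. norm ((max 0 h)\<^sup>2 / h) \<le> \<bar>h\<bar>"
        by (auto simp: max_def power2_eq_square)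
      show "((\<lambda>h::real. \<bar>h\<bar>) \<longlongrightarrow> 0) (at 0)" by (intro tendsto_rabs_zero tendsto_ident_at)
    qed
    then show ?thesis using 2 by (simp add: has_field_derivative_iff)
  next
    case 3
    have "((\<lambda>x. x\<^sup>2) has_real_derivative 2 * max 0 x) (at x)"
      using 3 by (auto intro!: derivative_eq_intros)
    then show ?thesis by (rule has_field_derivative_transform_within_open[of _ _ _ "{0<..}"]) (use 3 in auto)
  qed
qed

text \<open>With weight 1 and initial time 0 this is conservation of energy. Assuming only that the
  product \<open>p * r\<close> vanishes covers Dirichlet and Neumann walls alike, in any
  combination.\<close>

lemma wave_vanishes_between_walls:
  assumes wave: "wave_with_gradient c T a b v p q r" and c: "c > 0"
    and flux: "\<And>y t. y \<in> {0<..<pi} \<Longrightarrow> t \<in> {0<..<T} \<Longrightarrow> p (a, y, t) * r (a, y, t) = 0 \<and> p (b, y, t) * r (b, y, t) = 0"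
    and pt: "x \<in> {a<..<b}" "y \<in> {0<..<pi}" "t \<in> {0<..<T}"
  shows "v (x, y, t) = 0"
  by (rule weighted_energy_solution_vanishes(1)[OF wave c order_refl, where \<rho> = "\<lambda>_ _. 1"
        and \<rho>x = "\<lambda>_ _. 0" and \<rho>t = "\<lambda>_ _. 0"]) (use flux pt in auto)

text \<open>
  The weight \<open>(max 0 (x - a - c (t - s)))\<^sup>2\<close> is constant along the characteristics that enter
  through the uncontrolled end \<open>a\<close>.
\<close>

lemma wave_vanishes_before_signal:
  assumes wave: "wave_with_gradient c T a b v p q r" and c: "c > 0" and s: "0 \<le> s"
    and zero: "\<And>x y t. x \<in> {a<..<b} \<Longrightarrow> y \<in> {0<..<pi} \<Longrightarrow> t \<in> {0<..<T} \<Longrightarrow> t < s \<Longrightarrow> v (x, y, t) = 0"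
    and flux: "\<And>y t. y \<in> {0<..<pi} \<Longrightarrow> t \<in> {0<..<T} \<Longrightarrow> p (b, y, t) * r (b, y, t) = 0"
    and pt: "x \<in> {a<..<b}" "y \<in> {0<..<pi}" "t \<in> {0<..<T}" "c * (t - s) < x - a"
  shows "v (x, y, t) = 0 \<and> p (x, y, t) = 0"
proof (cases "t < s")
  case True
  \<comment> \<open>Before \<open>s\<close> the state at rest up to time \<open>t\<close> already
    yields both claims.\<close>
  have "v (x, y, s') = 0" if "x \<in> {a<..<b}" "y \<in> {0<..<pi}" "s' \<in> {0<..<t}" for x y s'
    using zero[OF that(1,2)] that(3) pt(3) True by auto
  from wave_rest_state(1,2)[OF wave _ _ this pt(1,2)] pt(3) show ?thesis by simp
next
  case False
  define m where "m x t = max 0 (x - a - c * (t - s))" for x t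
  have cont: "continuous_on UNIV (\<lambda>z. (m (fst z) (snd z))\<^sup>2)" "continuous_on UNIV (\<lambda>z. 2 * m (fst z) (snd z))"
    "continuous_on UNIV (\<lambda>z. 2 * m (fst z) (snd z) * - c)"
    unfolding m_def by (intro continuous_intros)+
  have mx: "((\<lambda>\<xi>. (m \<xi> t)\<^sup>2) has_real_derivative 2 * m x t) (at x)" for x t
  proof -
    have "((\<lambda>\<xi>. \<xi> - a - c * (t - s)) has_real_derivative 1) (at x)" by (auto intro!: derivative_eq_intros)
    from DERIV_chain2[OF has_derivative_max_0_sq this] show ?thesis by (simp add: m_def)
  qed
  have mt: "((\<lambda>\<tau>. (m x \<tau>)\<^sup>2) has_real_derivative 2 * m x t * - c) (at t)" for x t
  proof -
    have "((\<lambda>\<tau>. x - a - c * (\<tau> - s)) has_real_derivative - c) (at t)" by (auto intro!: derivative_eq_intros)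
    from DERIV_chain2[OF has_derivative_max_0_sq this] show ?thesis by (simp only: m_def)
  qed
  have decay: "2 * m x t * - c + c * \<bar>2 * m x t\<bar> \<le> 0" for x t
    by (simp add: m_def)
  \<comment> \<open>After time \<open>s\<close> the weight is zero at the end \<open>a\<close>, so
    nothing has to be known about the data there.\<close>
  have flux': "(m a t)\<^sup>2 * (p (a, y, t) * r (a, y, t)) = 0 \<and> (m b t)\<^sup>2 * (p (b, y, t) * r (b, y, t)) = 0"
    if "y \<in> {0<..<pi}" "t \<in> {s<..<T}" for y t
    using flux[OF that(1), of t] that(2) c s by (simp add: m_def)
  have zero': "v (x, y, t') = 0" if "x \<in> {a<..<b}" "y \<in> {0<..<pi}" "t' \<in> {0<..<s}" for x y t'
    using zero[OF that(1,2)] that(3) False pt(3) by auto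
  have pt': "t \<in> {s..<T}" "0 < (m x t)\<^sup>2" using False pt by (auto simp: m_def)
  note van = weighted_energy_solution_vanishes[OF wave c s, where \<rho> = "\<lambda>x t. (m x t)\<^sup>2"
      and \<rho>x = "\<lambda>x t. 2 * m x t" and \<rho>t = "\<lambda>x t. 2 * m x t * - c"]
  show ?thesis
    using van[OF cont(1-3) mx mt zero_le_power2 decay zero' flux' pt(1,2) pt'] by simp
qed

text \<open>The interior statement passes to the wall \<open>b\<close> by continuity of
  \<open>v\<close> and \<open>p\<close>.\<close>

lemma wave_trace_vanishes_before_signal:
  assumes wave: "wave_with_gradient c T a b v p q r" and c: "c > 0" and s: "0 \<le> s"
    and zero: "\<And>x y t. x \<in> {a<..<b} \<Longrightarrow> y \<in> {0<..<pi} \<Longrightarrow> t \<in> {0<..<T} \<Longrightarrow> t < s \<Longrightarrow> v (x, y, t) = 0"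
    and flux: "\<And>y t. y \<in> {0<..<pi} \<Longrightarrow> t \<in> {0<..<T} \<Longrightarrow> p (b, y, t) * r (b, y, t) = 0"
    and pt: "a < b" "y \<in> {0<..<pi}" "t \<in> {0<..<T}" "c * (t - s) < b - a"
  shows "v (b, y, t) = 0" "p (b, y, t) = 0"
proof -
  \<comment> \<open>The front that left \<open>a\<close> at time \<open>s\<close>; for
    \<open>t < s\<close> that formula would fall to the left of the strip, hence the
    maximum.\<close>
  define x0 where "x0 = max a (a + c * (t - s))"
  have x0: "x0 < b" "a \<le> x0" using pt by (auto simp: x0_def)
  have cl: "closure {x0<..<b} = {x0..b}" using x0 by simp
  have "v (x, y, t) = 0 \<and> p (x, y, t) = 0" if "x \<in> {x0<..<b}" for x
    by (rule wave_vanishes_before_signal[OF wave c s zero flux _ pt(2,3)]) (use that in \<open>auto simp: x0_def\<close>)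
  moreover have "continuous_on (closure {x0<..<b}) (\<lambda>x. f (x, y, t))" if "f \<in> {v, p}" for f
    unfolding cl by (rule continuous_on_compose2[OF wave_with_gradientD(1)[OF wave, of f]])
      (use that x0 pt in \<open>auto intro!: continuous_intros\<close>)
  moreover have "b \<in> closure {x0<..<b}" unfolding cl using x0 by simp
  ultimately show "v (b, y, t) = 0" "p (b, y, t) = 0"
    using continuous_constant_on_closure[of "{x0<..<b}" "\<lambda>x. v (x, y, t)" 0 b]
      continuous_constant_on_closure[of "{x0<..<b}" "\<lambda>x. p (x, y, t)" 0 b] by blast+
qed

text \<open>Both strips are cut to width \<open>h\<close> at \<open>m\<close> and the right one is
  folded onto the left. The difference has zero Dirichlet trace at \<open>m\<close>, so its normal
  derivative there vanishes until a signal arrives from \<open>m - h\<close>; the minus sign comes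
  from the reflection.\<close>

lemma normal_derivatives_agree_before_signal:
  assumes u: "wave_with_gradient c T a m u p q r" "wave_with_gradient c T m b u' p' q' r'"
    and c: "c > 0" and s: "0 \<le> s" and h: "0 < h" "h \<le> m - a" "h \<le> b - m"
    and zero: "\<And>x y t. x \<in> {a<..<m} \<Longrightarrow> y \<in> {0<..<pi} \<Longrightarrow> t \<in> {0<..<T} \<Longrightarrow> t < s \<Longrightarrow> u (x, y, t) = 0"
      "\<And>x y t. x \<in> {m<..<b} \<Longrightarrow> y \<in> {0<..<pi} \<Longrightarrow> t \<in> {0<..<T} \<Longrightarrow> t < s \<Longrightarrow> u' (x, y, t) = 0"
    and trace: "\<And>y t. y \<in> {0<..<pi} \<Longrightarrow> t \<in> {0<..<T} \<Longrightarrow> u (m, y, t) = u' (m, y, t)"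
    and pt: "y \<in> {0<..<pi}" "t \<in> {0<..<T}" "c * (t - s) < h"
  shows "p (m, y, t) = - p' (m, y, t)"
proof -
  have "wave_with_gradient c T (m - h) m u p q r" using wave_restrict[OF u(1)] h by simp
  moreover have "wave_with_gradient c T (m - h) m (\<lambda>z. u' (2 * m - fst z, snd z)) (\<lambda>z. - p' (2 * m - fst z, snd z))
    (\<lambda>z. q' (2 * m - fst z, snd z)) (\<lambda>z. r' (2 * m - fst z, snd z))"
    by (rule wave_restrict[OF wave_reflect[OF u(2)]]) (use h in auto)
  ultimately have diff: "wave_with_gradient c T (m - h) m (\<lambda>z. 1 * u z + - 1 * u' (2 * m - fst z, snd z))
    (\<lambda>z. 1 * p z + - 1 * - p' (2 * m - fst z, snd z)) (\<lambda>z. 1 * q z + - 1 * q' (2 * m - fst z, snd z))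
    (\<lambda>z. 1 * r z + - 1 * r' (2 * m - fst z, snd z))"
    by (rule wave_combine)
  have "1 * r (m, y, t) + - 1 * r' (2 * m - fst (m, y, t), snd (m, y, t)) = 0"
    if "y \<in> {0<..<pi}" "t \<in> {0<..<T}" for y t
    using wave_velocity_eq_0[OF diff, of m y 0 T t] trace that h by simp
  then have "1 * p (m, y, t) + - 1 * - p' (2 * m - fst (m, y, t), snd (m, y, t)) = 0"
    by (intro wave_trace_vanishes_before_signal(2)[OF diff c s]) (use zero h pt in auto)
  then show ?thesis by simp
qed

text \<open>At \<open>m\<close> the field \<open>\<phi> - 2 u\<close> has x-derivative
  \<open>- (p + p')\<close>, and the folded \<open>\<phi>' - 2 u'\<close> has \<open>p + p'\<close>.
  Their sum thus has zero Neumann data at all times, even after the two normal derivatives of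
  \<open>u\<close> cease to agree. Here \<open>s\<close> is the time up to which the doubling
  holds.\<close>

lemma neumann_traces_sum_before_signal:
  assumes u: "wave_with_gradient c T a m u p q r" "wave_with_gradient c T m b u' p' q' r'"
    and \<phi>: "wave_with_gradient c T a m \<phi> P Q R" "wave_with_gradient c T m b \<phi>' P' Q' R'"
    and c: "c > 0" and s: "0 \<le> s" and h: "0 < h" "h \<le> m - a" "h \<le> b - m"
    and double: "\<And>x y t. x \<in> {a<..<m} \<Longrightarrow> y \<in> {0<..<pi} \<Longrightarrow> t \<in> {0<..<T} \<Longrightarrow> t < s \<Longrightarrow> \<phi> (x, y, t) = 2 * u (x, y, t)"
      "\<And>x y t. x \<in> {m<..<b} \<Longrightarrow> y \<in> {0<..<pi} \<Longrightarrow> t \<in> {0<..<T} \<Longrightarrow> t < s \<Longrightarrow> \<phi>' (x, y, t) = 2 * u' (x, y, t)"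
    and neumann: "\<And>y t. y \<in> {0<..<pi} \<Longrightarrow> t \<in> {0<..<T} \<Longrightarrow> P (m, y, t) = p (m, y, t) - p' (m, y, t)"
      "\<And>y t. y \<in> {0<..<pi} \<Longrightarrow> t \<in> {0<..<T} \<Longrightarrow> - P' (m, y, t) = p (m, y, t) - p' (m, y, t)"
    and pt: "y \<in> {0<..<pi}" "t \<in> {0<..<T}" "c * (t - s) < h"
  shows "\<phi> (m, y, t) + \<phi>' (m, y, t) = 2 * (u (m, y, t) + u' (m, y, t))"
proof -
  note left = wave_restrict[OF wave_combine[OF \<phi>(1) u(1), of 1 "- 2"], of "m - h" m T]
  note right = wave_restrict[OF wave_reflect[OF wave_combine[OF \<phi>(2) u(2), of 1 "- 2"], of "2 * m"], of "m - h" m T]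
  note sum = wave_combine[OF left right, of 1 1]
  have "1 * (1 * \<phi> (m, y, t) + - 2 * u (m, y, t)) +
      1 * (1 * \<phi>' (2 * m - fst (m, y, t), snd (m, y, t)) + - 2 * u' (2 * m - fst (m, y, t), snd (m, y, t))) = 0"
    by (rule wave_trace_vanishes_before_signal(1)[OF sum c s]) (use neumann double h pt in auto)
  then show ?thesis by simp
qed

subsection \<open>The iteration\<close>

text \<open>The travel time \<open>h / c\<close> is gained twice: first the doubling
  \<open>\<phi> = 2 u\<close> extends from \<open>s\<close> to \<open>s + h / c\<close>, then the
  interface identity holds for another \<open>h / c\<close>. The factor 4 is a doubling on each of
  two sides.\<close>

lemma nnwr_correction_eq:
  fixes x :: "nat \<Rightarrow> real"
  assumes c: "c > 0" and h: "h > 0" and gap: "\<And>j. j \<in> {1..N} \<Longrightarrow> h \<le> x j - x (j - 1)"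
    and dir: "dirichlet_step c T N x w u" and neu: "neumann_step c T N x u \<phi>"
    and ends: "\<And>y t. y \<in> {0<..<pi} \<Longrightarrow> t \<in> {0<..<T} \<Longrightarrow> w 0 y t = 0 \<and> w N y t = 0"
    and s: "0 \<le> s"
    and zero: "\<And>j y t. j \<in> {1..N - 1} \<Longrightarrow> y \<in> {0<..<pi} \<Longrightarrow> t \<in> {0<..<T} \<Longrightarrow> t < s \<Longrightarrow> w j y t = 0"
    and i: "i \<in> {1..N - 1}" and yt: "y \<in> {0<..<pi}" "t \<in> {0<..<T}" "c * (t - s) < 2 * h"
  shows "\<phi> i (x i, y, t) + \<phi> (i + 1) (x i, y, t) = 4 * w i y t"
proof -
  define ux where "ux j = Dx {x (j - 1)..x j} (u j)" for j
  define \<phi>x where "\<phi>x j = Dx {x (j - 1)..x j} (\<phi> j)" for j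
  have w0: "w j y t = 0" if "j \<le> N" "y \<in> {0<..<pi}" "t \<in> {0<..<T}" "t < s" for j y t
  proof -
    consider "j = 0" | "j = N" | "j \<in> {1..N - 1}" using \<open>j \<le> N\<close> by fastforce
    then show ?thesis using ends[OF that(2,3)] zero[OF _ that(2-4)] by cases auto
  qed
  have less: "x (j - 1) < x j" if "j \<in> {1..N}" for j using gap[OF that] h by simp
  have u: "wave_with_gradient c T (x (j - 1)) (x j) (u j) (ux j)
      (Dy {0..pi} (u j)) (Dt {0..<T} (u j))"
    and u_trace: "\<And>y t. y \<in> {0<..<pi} \<Longrightarrow> t \<in> {0<..<T} \<Longrightarrow>
      u j (x (j - 1), y, t) = w (j - 1) y t \<and> u j (x j, y, t) = w j y t" if "j \<in> {1..N}" for j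
    using dir that unfolding dirichlet_step_def ux_def by (auto intro: wave_solution_gradient)
  have \<phi>: "wave_with_gradient c T (x (j - 1)) (x j) (\<phi> j) (\<phi>x j)
      (Dy {0..pi} (\<phi> j)) (Dt {0..<T} (\<phi> j))" if "j \<in> {1..N}" for j
    using neu that unfolding neumann_step_def \<phi>x_def by (auto intro: wave_solution_gradient)
  have \<phi>_left: "if j = 1 then \<phi> j (x (j - 1), y, t) = 0
      else \<phi>x j (x (j - 1), y, t) = ux j (x (j - 1), y, t) - ux (j - 1) (x (j - 1), y, t)"
    if "j \<in> {1..N}" "y \<in> {0<..<pi}" "t \<in> {0<..<T}" for j y t
  proof -
    have "if j = 1 then \<phi> j (x 0, y, t) = 0
        else dn_left (x (j - 1)) (x j) (\<phi> j) y t
          = dn_right (x (j - 2)) (x (j - 1)) (u (j - 1)) y t + dn_left (x (j - 1)) (x j) (u j) y t"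
      using neu that unfolding neumann_step_def by blast
    \<comment> \<open>This matches the left end of subdomain \<open>j - 1\<close> as written in
      \<open>neumann_step\<close> with the one in \<open>ux (j - 1)\<close>.\<close>
    moreover have "j - 2 = j - 1 - 1" by simp
    ultimately show ?thesis unfolding dn_left_def dn_right_def ux_def \<phi>x_def by (cases "j = 1") simp_all
  qed
  have \<phi>_right: "if j = N then \<phi> j (x j, y, t) = 0
      else \<phi>x j (x j, y, t) = ux j (x j, y, t) - ux (j + 1) (x j, y, t)"
    if "j \<in> {1..N}" "y \<in> {0<..<pi}" "t \<in> {0<..<T}" for j y t
  proof -
    have "if j = N then \<phi> j (x N, y, t) = 0
        else dn_right (x (j - 1)) (x j) (\<phi> j) y t
          = dn_right (x (j - 1)) (x j) (u j) y t + dn_left (x j) (x (j + 1)) (u (j + 1)) y t"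
      using neu that unfolding neumann_step_def by blast
    then show ?thesis unfolding dn_left_def dn_right_def ux_def \<phi>x_def by (cases "j = N") simp_all
  qed
  have u0: "u j (\<xi>, y, t) = 0"
    if j: "j \<in> {1..N}" and pt: "\<xi> \<in> {x (j - 1)<..<x j}" "y \<in> {0<..<pi}" "t \<in> {0<..<T}" "t < s" for j \<xi> y t
  proof -
    \<comment> \<open>The walls are known to be at rest only up to \<open>s\<close>, so the time
      window is cut there before conservation of energy is used.\<close>
    have wave: "wave_with_gradient c (min T s) (x (j - 1)) (x j) (u j) (ux j) (Dy {0..pi} (u j)) (Dt {0..<T} (u j))"
      by (rule wave_restrict[OF u[OF j]]) auto
    have "Dt {0..<T} (u j) (\<xi>, y, t) = 0"
      if "\<xi> \<in> {x (j - 1), x j}" "y \<in> {0<..<pi}" "t \<in> {0<..<min T s}" for \<xi> y t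
      by (rule wave_velocity_eq_0[OF wave, where \<alpha> = 0 and \<beta> = "min T s"])
        (use that j u_trace[OF j that(2)] w0 less[OF j] in auto)
    then show ?thesis
      by (intro wave_vanishes_between_walls[OF wave c]) (use pt in auto)
  qed
  have agree: "ux j (x j, y, t) = - ux (j + 1) (x j, y, t)"
    if j: "j \<in> {1..N - 1}" and yt: "y \<in> {0<..<pi}" "t \<in> {0<..<T}" "c * (t - s) < h" for j y t
  proof -
    have jN: "j \<in> {1..N}" "j + 1 \<in> {1..N}" using j by auto
    have u': "wave_with_gradient c T (x j) (x (j + 1)) (u (j + 1)) (ux (j + 1))
      (Dy {0..pi} (u (j + 1))) (Dt {0..<T} (u (j + 1)))" using u[OF jN(2)] by simp
    show ?thesis
      by (rule normal_derivatives_agree_before_signal[OF u[OF jN(1)] u' c s h])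
        (use gap[OF jN(1)] gap[OF jN(2)] u0[OF jN(1)] u0[OF jN(2)] u_trace[OF jN(1)] u_trace[OF jN(2)] yt in auto)
  qed
  \<comment> \<open>Before this time no signal released at \<open>s\<close> has crossed a distance
    \<open>h\<close>, so the normal derivatives agree at every interface.\<close>
  define s' where "s' = s + h / c"
  have s': "0 \<le> s'" using s h c by (simp add: s'_def)
  have cs': "c * s' = c * s + h" using c by (simp add: s'_def distrib_left)
  have before: "c * (t - s) < h" if "t < s'" for t
    using that c by (simp add: s'_def field_simps)
  have double: "\<phi> j (\<xi>, y, t) = 2 * u j (\<xi>, y, t)"
    if j: "j \<in> {1..N}" and pt: "\<xi> \<in> {x (j - 1)<..<x j}" "y \<in> {0<..<pi}" "t \<in> {0<..<T}" "t < s'" for j \<xi> y t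
  proof -
    note wave = wave_restrict[OF wave_combine[OF \<phi>[OF j] u[OF j], of 1 "- 2"], of "x (j - 1)" "x j" "min T s'"]
    have flux: "(1 * \<phi>x j (\<xi>, y, t) + - 2 * ux j (\<xi>, y, t)) *
        (1 * Dt {0..<T} (\<phi> j) (\<xi>, y, t) + - 2 * Dt {0..<T} (u j) (\<xi>, y, t)) = 0"
      if \<xi>: "\<xi> \<in> {x (j - 1), x j}" and yt: "y \<in> {0<..<pi}" "t \<in> {0<..<min T s'}" for \<xi> y t
    proof -
      have tT: "t \<in> {0<..<T}" "c * (t - s) < h" using yt before by auto
      \<comment> \<open>At an interior interface \<open>agree\<close> turns the Neumann data of
        \<phi> into twice the x-derivative of \<open>u\<close>, so the first factor vanishes. At the
        physical boundary \<phi> and \<open>u\<close> both vanish, hence the second factor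
        does.\<close>
      consider (left) "\<xi> = x (j - 1)" "j \<noteq> 1" | (right) "\<xi> = x j" "j \<noteq> N"
        | (boundary) "\<xi> = x (j - 1) \<and> j = 1 \<or> \<xi> = x j \<and> j = N" using \<xi> by auto
      then show ?thesis
      proof cases
        case left
        then have "j - 1 \<in> {1..N - 1}" "j - 1 + 1 = j" using j by auto
        then show ?thesis using agree[of "j - 1", OF _ yt(1) tT] \<phi>_left[OF j yt(1) tT(1)] left by simp
      next
        case right
        then have "j \<in> {1..N - 1}" using j by auto
        then show ?thesis using agree[of j, OF _ yt(1) tT] \<phi>_right[OF j yt(1) tT(1)] right by simp
      next
        case boundary
        have "1 * \<phi> j (\<xi>, y, s'') + - 2 * u j (\<xi>, y, s'') = 0" if "s'' \<in> {0<..<T}" for s''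
          using \<phi>_left[OF j yt(1) that] \<phi>_right[OF j yt(1) that] u_trace[OF j yt(1) that] ends[OF yt(1) that] boundary
          by (auto split: if_splits)
        then have "1 * Dt {0..<T} (\<phi> j) (\<xi>, y, t) + - 2 * Dt {0..<T} (u j) (\<xi>, y, t) = 0"
          by (intro wave_velocity_eq_0[OF wave_combine[OF \<phi>[OF j] u[OF j], of 1 "- 2"], where \<alpha> = 0 and \<beta> = T])
            (use \<xi> yt tT less[OF j] in auto)
        then show ?thesis by simp
      qed
    qed
    have "1 * \<phi> j (\<xi>, y, t) + - 2 * u j (\<xi>, y, t) = 0"
      by (rule wave_vanishes_between_walls[OF wave c]) (use pt flux in auto)
    then show ?thesis by simp
  qed
  have iN: "i \<in> {1..N}" "i + 1 \<in> {1..N}" using i by auto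
  have u': "wave_with_gradient c T (x i) (x (i + 1)) (u (i + 1)) (ux (i + 1))
      (Dy {0..pi} (u (i + 1))) (Dt {0..<T} (u (i + 1)))" using u[OF iN(2)] by simp
  have \<phi>': "wave_with_gradient c T (x i) (x (i + 1)) (\<phi> (i + 1)) (\<phi>x (i + 1))
      (Dy {0..pi} (\<phi> (i + 1))) (Dt {0..<T} (\<phi> (i + 1)))" using \<phi>[OF iN(2)] by simp
  have "c * (t - s') < h" using yt(3) cs' by (simp add: right_diff_distrib)
  then have "\<phi> i (x i, y, t) + \<phi> (i + 1) (x i, y, t) = 2 * (u i (x i, y, t) + u (i + 1) (x i, y, t))"
  proof (intro neumann_traces_sum_before_signal[OF u[OF iN(1)] u' \<phi>[OF iN(1)] \<phi>' c s' h])
    show "\<phi>x i (x i, y, t) = ux i (x i, y, t) - ux (i + 1) (x i, y, t)"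
      "- \<phi>x (i + 1) (x i, y, t) = ux i (x i, y, t) - ux (i + 1) (x i, y, t)"
      if "y \<in> {0<..<pi}" "t \<in> {0<..<T}" for y t
      using \<phi>_right[OF iN(1) that] \<phi>_left[OF iN(2) that] i by auto
  qed (use double[OF iN(1)] double[OF iN(2)] gap[OF iN(1)] gap[OF iN(2)] yt in auto)
  also have "\<dots> = 4 * w i y t"
    using u_trace[OF iN(1) yt(1,2)] u_trace[OF iN(2) yt(1,2)] by simp
  finally show ?thesis .
qed

text \<open>Before time \<open>2 * h * k / c\<close> the interface values are already zero by
  induction; over the next \<open>2 * h / c\<close> the correction is four times the old value, so
  the relaxation 1/4 removes it exactly. For \<open>k = 0\<close> the time range is empty.\<close>

lemma nnwr_interface_values_vanish:
  fixes x :: "nat \<Rightarrow> real"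
  assumes c: "c > 0" and h: "h > 0" and gap: "\<And>j. j \<in> {1..N} \<Longrightarrow> h \<le> x j - x (j - 1)"
    and nnwr: "NNWR c T N x (1/4) w u \<phi>"
    and "i \<in> {1..N - 1}" "y \<in> {0<..<pi}" "t \<in> {0<..<T}" "c * t < 2 * h * real k"
  shows "w k i y t = 0"
  using assms(5-)
proof (induction k arbitrary: i y t)
  case 0
  then show ?case using c by (simp add: mult_less_0_iff)
next
  case (Suc k)
  define s where "s = min t (2 * h * real k / c)"
  have s: "0 \<le> s" using Suc.prems h c by (simp add: s_def)
  have steps: "dirichlet_step c T N x (w k) (u (Suc k))" "neumann_step c T N x (u (Suc k)) (\<phi> (Suc k))"
    and ends: "\<And>y t. y \<in> {0<..<pi} \<Longrightarrow> t \<in> {0<..<T} \<Longrightarrow> w k 0 y t = 0 \<and> w k N y t = 0"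
    and upd: "w (Suc k) i y t = w k i y t - 1 / 4 * (\<phi> (Suc k) i (x i, y, t) + \<phi> (Suc k) (i + 1) (x i, y, t))"
    using nnwr Suc.prems unfolding NNWR_def by (auto dest: spec[of _ "Suc k"])
  have zero: "w k j y' t' = 0"
    if "j \<in> {1..N - 1}" "y' \<in> {0<..<pi}" "t' \<in> {0<..<T}" "t' < s" for j y' t'
    by (rule Suc.IH[OF that(1-3)]) (use that(4) c in \<open>simp add: s_def field_simps\<close>)
  have "c * (t - s) < 2 * h"
    using Suc.prems(4) c h by (simp add: s_def min_def field_simps)
  from nnwr_correction_eq[OF c h gap steps ends s zero Suc.prems(1-3) this] upd show ?case by simp
qed

theorem theorem3p2:
  fixes c l L T :: real and N k :: nat and x :: "nat \<Rightarrow> real"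
    and w :: "nat \<Rightarrow> nat \<Rightarrow> real \<Rightarrow> real \<Rightarrow> real"
    and u \<phi> :: "nat \<Rightarrow> nat \<Rightarrow> field"
  assumes "c > 0" and "l < L" and "N \<ge> 2"
    and "x 0 = l" and "x N = L" and "\<forall>i<N. x i < x (i + 1)"
    and "k \<ge> 1" and "T > 0"
    and "T / real k < 2 * Min ((\<lambda>i. x i - x (i - 1)) ` {1..N}) / c"
    and "NNWR c T N x (1/4) w u \<phi>"
  shows "\<forall>i\<in>{1..N}. \<forall>\<xi>\<in>{x (i - 1)<..<x i}. \<forall>y\<in>{0<..<pi}. \<forall>t\<in>{0<..<T}.
           u (k + 1) i (\<xi>, y, t) = 0"
proof (intro ballI)
  fix i \<xi> y t
  assume i: "i \<in> {1..N}" and pt: "\<xi> \<in> {x (i - 1)<..<x i}" "y \<in> {0<..<pi}" "t \<in> {0<..<T}"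
  define h where "h = Min ((\<lambda>i. x i - x (i - 1)) ` {1..N})"
  have ne: "(\<lambda>i. x i - x (i - 1)) ` {1..N} \<noteq> {}" using \<open>N \<ge> 2\<close> by simp
  have "0 < x j - x (j - 1)" if "j \<in> {1..N}" for j
    using assms(6)[rule_format, of "j - 1"] that by (cases j) auto
  then have h: "h > 0" unfolding h_def using ne by (subst Min_gr_iff) auto
  have gap: "h \<le> x j - x (j - 1)" if "j \<in> {1..N}" for j
    unfolding h_def by (rule Min_le) (use that in auto)
  \<comment> \<open>The condition on the window says that \<open>k\<close> iterations clear all of
    it.\<close>
  have cT: "c * T < 2 * h * real k"
    using assms(1,7,9) unfolding h_def[symmetric] by (simp add: field_simps)
  have before: "c * t < 2 * h * real k" if "t < T" for t
    using mult_strict_left_mono[OF that \<open>c > 0\<close>] cT by linarith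
  have w0: "w k j y t = 0" if "j \<le> N" "y \<in> {0<..<pi}" "t \<in> {0<..<T}" for j y t
  proof -
    consider "j \<in> {0, N}" | "j \<in> {1..N - 1}" using \<open>j \<le> N\<close> by fastforce
    then show ?thesis
    proof cases
      case 1
      then show ?thesis using assms(10) that unfolding NNWR_def by blast
    next
      case 2
      then show ?thesis
        using nnwr_interface_values_vanish[OF assms(1) h gap assms(10) 2 that(2,3)] before that(3) by simp
    qed
  qed
  \<comment> \<open>The extra iteration: zero interface values first enter the Dirichlet step with
    index \<open>k + 1\<close>, and conservation of energy makes its solution zero.\<close>
  have "dirichlet_step c T N x (w k) (u (k + 1))"
    using assms(10) unfolding NNWR_def by (auto dest: spec[of _ "k + 1"])
  then have sol: "wave_solution c T (x (i - 1)) (x i) (u (k + 1) i)"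
    and trace: "\<And>y t. y \<in> {0<..<pi} \<Longrightarrow> t \<in> {0<..<T} \<Longrightarrow>
      u (k + 1) i (x (i - 1), y, t) = 0 \<and> u (k + 1) i (x i, y, t) = 0"
    using i w0 unfolding dirichlet_step_def by auto
  note wave = wave_solution_gradient[OF sol]
  have "Dt {0..<T} (u (k + 1) i) (\<xi>, y, t) = 0"
    if "\<xi> \<in> {x (i - 1), x i}" "y \<in> {0<..<pi}" "t \<in> {0<..<T}" for \<xi> y t
    by (rule wave_velocity_eq_0[OF wave, where \<alpha> = 0 and \<beta> = T]) (use that trace pt(1) in auto)
  then show "u (k + 1) i (\<xi>, y, t) = 0"
    by (intro wave_vanishes_between_walls[OF wave assms(1) _ pt]) auto
qed

end
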